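(* Let $k\ge2$, $\theta\in(0,1]$, and let $P=\sum_{i=0}^{s}a_i(1-P_1)^{b_i}P_2^{c_i}$ with real $a_i$ and nonnegative integers $b_i,c_i$, and $F$ as in the context. Then $$\widetilde{L}_k(F)=\sum_{0\le i,j\le s}a_ia_j\sum_{c_1'=0}^{c_i}\sum_{c_2'=0}^{c_j}\binom{c_i}{c_1'}\binom{c_j}{c_2'}Q_{c_1'+c_2'}(k-1)\Bigg(\sum_{d_1=0}^{\tilde d}\frac{(-1)^{d_1}\binom{\tilde d}{d_1}\delta_{i,j,c_1',c_2'}\lambda_{k-1+d_1+2c_1'+2c_2'}}{(k+2c_1'+2c_2'-2)!\,(k-1+2c_1'+2c_2'+d_1)}$$ $$-\sum_{b_1'=0}^{b_i}\sum_{e_1=0}^{\tilde e}\frac{(-1)^{e_1+b_1'}\binom{\tilde e}{e_1}\binom{b_i}{b_1'}\varepsilon_{i,j,c_1',c_2',b_1'}\,\mu_{b_1'+2c_i-2c_1'+1,\ k-1+e_1+2c_1'+2c_2'}}{(k+2c_1'+2c_2'-2)!\,(k-1+2c_1'+2c_2'+e_1)}\Bigg)$$ and $$\widetilde{M}_k(F)=\frac{\theta}{2}\sum_{0\le i,j\le s}a_ia_j\sum_{c_1'=0}^{c_i}\sum_{c_2'=0}^{c_j}\binom{c_i}{c_1'}\binom{c_j}{c_2'}Q_{c_1'+c_2'}(k-1)\Bigg(\sum_{d_1=0}^{\tilde d}\frac{(-1)^{d_1}\binom{\tilde d}{d_1}\delta_{i,j,c_1',c_2'}\lambda_{k-1+d_1+2c_1'+2c_2'}}{(k+2c_1'+2c_2'-2)!\,(k-1+2c_1'+2c_2'+d_1)}$$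 $$-2\sum_{b_1'=0}^{b_i}\sum_{e_1=0}^{\tilde e}\frac{(-1)^{e_1+b_1'}\binom{\tilde e}{e_1}\binom{b_i}{b_1'}\varepsilon_{i,j,c_1',c_2',b_1'}\,\mu_{b_1'+2c_i-2c_1'+1,\ k-1+e_1+2c_1'+2c_2'}}{(k+2c_1'+2c_2'-2)!\,(k-1+2c_1'+2c_2'+e_1)}$$ $$+\sum_{b_1'=0}^{b_i}\sum_{b_2'=0}^{b_j}\sum_{f_1=0}^{\tilde f}\frac{(-1)^{f_1+b_1'+b_2'}\binom{\tilde f}{f_1}\binom{b_i}{b_1'}\binom{b_j}{b_2'}\,\mu_{2c_i+2c_j-2c_1'-2c_2'+b_1'+b_2'+2,\ k-1+f_1+2c_1'+2c_2'}}{\zeta_{i,j,c_1',c_2',b_1',b_2'}\,(k+2c_1'+2c_2'-2)!\,(k-1+2c_1'+2c_2'+f_1)}\Bigg),$$ where $\tilde d=b_i+b_j+2c_i+2c_j-2c_1'-2c_2'+2$, $\tilde e=b_i-b_1'+b_j+2c_j-2c_2'+1$, $\tilde f=b_i+b_j-b_1'-b_2'$, $$\delta_{i,j,c_1',c_2'}=\frac{b_i!\,b_j!\,(2c_i-2c_1')!\,(2c_j-2c_2')!}{(b_i+2c_i-2c_1'+1)!\,(b_j+2c_j-2c_2'+1)!},\quad \varepsilon_{i,j,c_1',c_2',b_1'}=\frac{b_j!\,(2c_j-2c_2')!}{(b_j+2c_j-2c_2'+1)!\,(b_1'+2c_i-2c_1'+1)},$$ $$\zeta_{i,j,c_1',c_2',b_1',b_2'}=(b_1'+2c_i-2c_1'+1)(b_2'+2c_j-2c_2'+1),$$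 $$\lambda_m=\frac{\theta}{2}\left(\frac{\theta}{2}\frac{{}_2F_1(1,1;m+2;\theta/2)}{m+1}-H_m+\log\left(1-\frac{\theta}{2}\right)\right),\qquad \mu_{m,n}=\frac{\theta}{2}\frac{{}_2F_1(1,m;m+n+1;\theta/2)}{m\binom{m+n}{n}},$$ with ${}_2F_1$ the Gauss hypergeometric function and $H_m$ the $m$-th harmonic number. (In particular the limits defining $\widetilde{L}_k(F)$ and $\widetilde{M}_k(F)$ exist.)
   Context: $P_i=x_1^i+\cdots+x_k^i$ denotes the $i$-th power sum symmetric polynomial in $k$ variables. $\mathcal{R}_k=\{(x_1,\dots,x_k): x_i\ge0,\ \sum x_i\le1\}$. $F:\mathbb{R}^k\to\mathbb{R}$ equals $P(x_1,\dots,x_k)$ on $\mathcal{R}_k$ and $0$ outside. $Q_0(x)=1$ and for $c\ge1$, $Q_c(x)=c!\sum_{r=1}^{c}\binom{x}{r}\sum_{c_1+\cdots+c_r=c,\ c_j\ge1}\prod_{j=1}^r\frac{(2c_j)!}{c_j!}$. For $0<\eta<\theta/2$ define $F_\xi(x_1,\dots,x_k)=F\big(\tfrac{2\xi}{\theta}+(1-\tfrac{2\xi}{\theta})x_1,x_2,\dots,x_k\big)$ and $J_k(F)=\int_0^1\!\cdots\!\int_0^1\left(\int_0^1F\,dx_1\right)^2dx_2\cdots dx_k$, $L_k(F)=\int_\eta^{\theta/2}\frac{\theta/2-\xi}{\xi(1-\xi)}\int_0^1\!\cdots\!\int_0^1\left(\int_0^1F_\xi\,dx_1\right)\left(\int_0^1F\,dx_1\right)dx_2\cdots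 dx_k\,d\xi$, $M_k(F)=\int_\eta^{\theta/2}\frac{(\theta/2-\xi)^2}{\xi(1-\xi)}\int_0^1\!\cdots\!\int_0^1\left(\int_0^1F_\xi\,dx_1\right)^2dx_2\cdots dx_k\,d\xi$ (these depend on $\eta$). Define $\widetilde{L}_k(F)=\lim_{\eta\to0^+}\Big(L_k(F)-\frac{\theta}{2}\log\Big(\frac{1-\eta}{\eta(\frac2\theta-1)}\Big)J_k(F)\Big)$ and $\widetilde{M}_k(F)=\lim_{\eta\to0^+}\Big(M_k(F)-\frac{\theta^2}{4}\log\Big(\frac{1-\eta}{\eta(\frac2\theta-1)}\Big)J_k(F)\Big)$. *)

theory Defs
  imports "HOL-Analysis.Analysis"
begin

text \<open>Points of R^k are functions x :: nat => real; coordinates x 1, ..., x k.\<close>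

definition P1 :: "nat \<Rightarrow> (nat \<Rightarrow> real) \<Rightarrow> real" where
  "P1 k x = (\<Sum>i=1..k. x i)"

definition P2 :: "nat \<Rightarrow> (nat \<Rightarrow> real) \<Rightarrow> real" where
  "P2 k x = (\<Sum>i=1..k. (x i)^2)"

definition in_Rk :: "nat \<Rightarrow> (nat \<Rightarrow> real) \<Rightarrow> bool" where
  "in_Rk k x \<longleftrightarrow> (\<forall>i\<in>{1..k}. 0 \<le> x i) \<and> P1 k x \<le> 1"

definition Ppoly :: "nat \<Rightarrow> nat \<Rightarrow> (nat \<Rightarrow> real) \<Rightarrow> (nat \<Rightarrow> nat) \<Rightarrow> (nat \<Rightarrow> nat)
    \<Rightarrow> (nat \<Rightarrow> real) \<Rightarrow> real" where
  "Ppoly k s a b c x = (\<Sum>i=0..s. a i * (1 - P1 k x) ^ b i * (P2 k x) ^ c i)"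

definition FF :: "nat \<Rightarrow> nat \<Rightarrow> (nat \<Rightarrow> real) \<Rightarrow> (nat \<Rightarrow> nat) \<Rightarrow> (nat \<Rightarrow> nat)
    \<Rightarrow> (nat \<Rightarrow> real) \<Rightarrow> real" where
  "FF k s a b c x = (if in_Rk k x then Ppoly k s a b c x else 0)"

fun iint :: "nat list \<Rightarrow> ((nat \<Rightarrow> real) \<Rightarrow> real) \<Rightarrow> (nat \<Rightarrow> real) \<Rightarrow> real" where
  "iint [] g y = g y"
| "iint (i # is) g y = integral {0..1} (\<lambda>t. iint is g (y(i := t)))"

definition cube_int :: "nat \<Rightarrow> ((nat \<Rightarrow> real) \<Rightarrow> real) \<Rightarrow> real" where
  "cube_int k g = iint [2..<k+1] g (\<lambda>_. 0)"

definition innerF :: "nat \<Rightarrow> nat \<Rightarrow> (nat \<Rightarrow> real) \<Rightarrow> (nat \<Rightarrow> nat) \<Rightarrow> (nat \<Rightarrow> nat)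
    \<Rightarrow> (nat \<Rightarrow> real) \<Rightarrow> real" where
  "innerF k s a b c y = integral {0..1} (\<lambda>t. FF k s a b c (y(1 := t)))"

definition innerFxi :: "nat \<Rightarrow> real \<Rightarrow> real \<Rightarrow> nat \<Rightarrow> (nat \<Rightarrow> real) \<Rightarrow> (nat \<Rightarrow> nat)
    \<Rightarrow> (nat \<Rightarrow> nat) \<Rightarrow> (nat \<Rightarrow> real) \<Rightarrow> real" where
  "innerFxi k \<theta> \<xi> s a b c y =
     integral {0..1} (\<lambda>t. FF k s a b c (y(1 := 2*\<xi>/\<theta> + (1 - 2*\<xi>/\<theta>) * t)))"

definition Jk :: "nat \<Rightarrow> nat \<Rightarrow> (nat \<Rightarrow> real) \<Rightarrow> (nat \<Rightarrow> nat) \<Rightarrow> (nat \<Rightarrow> nat) \<Rightarrow> real" where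
  "Jk k s a b c = cube_int k (\<lambda>y. (innerF k s a b c y)^2)"

definition Lk :: "nat \<Rightarrow> real \<Rightarrow> nat \<Rightarrow> (nat \<Rightarrow> real) \<Rightarrow> (nat \<Rightarrow> nat) \<Rightarrow> (nat \<Rightarrow> nat)
    \<Rightarrow> real \<Rightarrow> real" where
  "Lk k \<theta> s a b c \<eta> = integral {\<eta>..\<theta>/2} (\<lambda>\<xi>.
      (\<theta>/2 - \<xi>) / (\<xi> * (1 - \<xi>)) *
      cube_int k (\<lambda>y. innerFxi k \<theta> \<xi> s a b c y * innerF k s a b c y))"

definition Mk :: "nat \<Rightarrow> real \<Rightarrow> nat \<Rightarrow> (nat \<Rightarrow> real) \<Rightarrow> (nat \<Rightarrow> nat) \<Rightarrow> (nat \<Rightarrow> nat)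
    \<Rightarrow> real \<Rightarrow> real" where
  "Mk k \<theta> s a b c \<eta> = integral {\<eta>..\<theta>/2} (\<lambda>\<xi>.
      (\<theta>/2 - \<xi>)^2 / (\<xi> * (1 - \<xi>)) *
      cube_int k (\<lambda>y. (innerFxi k \<theta> \<xi> s a b c y)^2))"

definition Qc :: "nat \<Rightarrow> real \<Rightarrow> real" where
  "Qc c x = (if c = 0 then 1 else
     fact c * (\<Sum>r=1..c. (x gchoose r) *
       (\<Sum>cs\<in>{cs :: nat list. length cs = r \<and> (\<forall>cj\<in>set cs. 1 \<le> cj) \<and> sum_list cs = c}.
          (\<Prod>cj\<leftarrow>cs. fact (2*cj) / fact cj))))"

definition hyp2F1 :: "real \<Rightarrow> real \<Rightarrow> real \<Rightarrow> real \<Rightarrow> real" where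
  "hyp2F1 a b c z = (\<Sum>n. pochhammer a n * pochhammer b n / (pochhammer c n * fact n) * z ^ n)"

definition lam :: "real \<Rightarrow> nat \<Rightarrow> real" where
  "lam \<theta> m = \<theta>/2 * (\<theta>/2 * hyp2F1 1 1 (real m + 2) (\<theta>/2) / (real m + 1)
                      - harm m + ln (1 - \<theta>/2))"

definition mu :: "real \<Rightarrow> nat \<Rightarrow> nat \<Rightarrow> real" where
  "mu \<theta> m n = \<theta>/2 * hyp2F1 1 (real m) (real m + real n + 1) (\<theta>/2)
                 / (real m * real ((m + n) choose n))"

definition delta :: "(nat \<Rightarrow> nat) \<Rightarrow> (nat \<Rightarrow> nat) \<Rightarrow> nat \<Rightarrow> nat \<Rightarrow> nat \<Rightarrow> nat \<Rightarrow> real" where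
  "delta b c i j c1 c2 =
     fact (b i) * fact (b j) * fact (2*c i - 2*c1) * fact (2*c j - 2*c2)
     / (fact (b i + 2*c i - 2*c1 + 1) * fact (b j + 2*c j - 2*c2 + 1))"

definition eps :: "(nat \<Rightarrow> nat) \<Rightarrow> (nat \<Rightarrow> nat) \<Rightarrow> nat \<Rightarrow> nat \<Rightarrow> nat \<Rightarrow> nat \<Rightarrow> nat \<Rightarrow> real" where
  "eps b c i j c1 c2 b1 =
     fact (b j) * fact (2*c j - 2*c2)
     / (fact (b j + 2*c j - 2*c2 + 1) * real (b1 + 2*c i - 2*c1 + 1))"

definition zeta :: "(nat \<Rightarrow> nat) \<Rightarrow> (nat \<Rightarrow> nat) \<Rightarrow> nat \<Rightarrow> nat \<Rightarrow> nat \<Rightarrow> nat \<Rightarrow> nat \<Rightarrow> nat \<Rightarrow> real" where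
  "zeta b c i j c1 c2 b1 b2 =
     real (b1 + 2*c i - 2*c1 + 1) * real (b2 + 2*c j - 2*c2 + 1)"

definition Dsum :: "nat \<Rightarrow> real \<Rightarrow> (nat \<Rightarrow> nat) \<Rightarrow> (nat \<Rightarrow> nat) \<Rightarrow> nat \<Rightarrow> nat \<Rightarrow> nat \<Rightarrow> nat \<Rightarrow> real" where
  "Dsum k \<theta> b c i j c1 c2 =
     (let dt = b i + b j + 2*c i + 2*c j - 2*c1 - 2*c2 + 2 in
      \<Sum>d1=0..dt. (-1::real)^d1 * real (dt choose d1) * delta b c i j c1 c2
          * lam \<theta> (k - 1 + d1 + 2*c1 + 2*c2)
        / (fact (k + 2*c1 + 2*c2 - 2) * real (k - 1 + 2*c1 + 2*c2 + d1)))"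

definition Esum :: "nat \<Rightarrow> real \<Rightarrow> (nat \<Rightarrow> nat) \<Rightarrow> (nat \<Rightarrow> nat) \<Rightarrow> nat \<Rightarrow> nat \<Rightarrow> nat \<Rightarrow> nat \<Rightarrow> real" where
  "Esum k \<theta> b c i j c1 c2 =
     (\<Sum>b1=0..b i. let et = b i - b1 + b j + 2*c j - 2*c2 + 1 in
      \<Sum>e1=0..et. (-1::real)^(e1 + b1) * real (et choose e1) * real (b i choose b1)
          * eps b c i j c1 c2 b1 * mu \<theta> (b1 + 2*c i - 2*c1 + 1) (k - 1 + e1 + 2*c1 + 2*c2)
        / (fact (k + 2*c1 + 2*c2 - 2) * real (k - 1 + 2*c1 + 2*c2 + e1)))"

definition Fsum :: "nat \<Rightarrow> real \<Rightarrow> (nat \<Rightarrow> nat) \<Rightarrow> (nat \<Rightarrow> nat) \<Rightarrow> nat \<Rightarrow> nat \<Rightarrow> nat \<Rightarrow> nat \<Rightarrow> real" where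
  "Fsum k \<theta> b c i j c1 c2 =
     (\<Sum>b1=0..b i. \<Sum>b2=0..b j. let ft = b i + b j - b1 - b2 in
      \<Sum>f1=0..ft. (-1::real)^(f1 + b1 + b2) * real (ft choose f1) * real (b i choose b1)
          * real (b j choose b2)
          * mu \<theta> (2*c i + 2*c j - 2*c1 - 2*c2 + b1 + b2 + 2) (k - 1 + f1 + 2*c1 + 2*c2)
        / (zeta b c i j c1 c2 b1 b2 * fact (k + 2*c1 + 2*c2 - 2) * real (k - 1 + 2*c1 + 2*c2 + f1)))"

definition Ltilde_formula :: "nat \<Rightarrow> real \<Rightarrow> nat \<Rightarrow> (nat \<Rightarrow> real) \<Rightarrow> (nat \<Rightarrow> nat) \<Rightarrow> (nat \<Rightarrow> nat) \<Rightarrow> real" where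
  "Ltilde_formula k \<theta> s a b c =
     (\<Sum>i=0..s. \<Sum>j=0..s. a i * a j *
        (\<Sum>c1=0..c i. \<Sum>c2=0..c j. real (c i choose c1) * real (c j choose c2)
            * Qc (c1 + c2) (real (k - 1))
            * (Dsum k \<theta> b c i j c1 c2 - Esum k \<theta> b c i j c1 c2)))"

definition Mtilde_formula :: "nat \<Rightarrow> real \<Rightarrow> nat \<Rightarrow> (nat \<Rightarrow> real) \<Rightarrow> (nat \<Rightarrow> nat) \<Rightarrow> (nat \<Rightarrow> nat) \<Rightarrow> real" where
  "Mtilde_formula k \<theta> s a b c = \<theta>/2 *
     (\<Sum>i=0..s. \<Sum>j=0..s. a i * a j *
        (\<Sum>c1=0..c i. \<Sum>c2=0..c j. real (c i choose c1) * real (c j choose c2)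
            * Qc (c1 + c2) (real (k - 1))
            * (Dsum k \<theta> b c i j c1 c2 - 2 * Esum k \<theta> b c i j c1 c2 + Fsum k \<theta> b c i j c1 c2)))"

end

theory Submission
  imports Defs
begin

text \<open>
  Write \<open>u = 2\<xi>/\<theta>\<close>, \<open>r = 1 - u\<close> and \<open>S = x\<^sub>2 + \<dots> + x\<^sub>k\<close>. The inner integral of \<open>F\<^sub>\<xi>\<close> vanishes unless
  \<open>S \<le> r\<close>, where it equals \<open>1/r\<close> times the integral of \<open>F\<close> over \<open>u \<le> x\<^sub>1 \<le> 1 - S\<close>, and writing the
  latter as the integral over \<open>[0, 1 - S]\<close> minus the integral over \<open>[0, u]\<close> gives a polynomial in \<open>u\<close>,
  \<open>1 - S\<close> and \<open>x\<^sub>2\<^sup>2 + \<dots> + x\<^sub>k\<^sup>2\<close>. The moments of \<open>(1 - S)\<^sup>p (x\<^sub>2\<^sup>2 + \<dots> + x\<^sub>k\<^sup>2)\<^sup>n\<close> over \<open>S \<le> r\<close> are explicit,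
  with \<open>Q\<^sub>n(k - 1)\<close> as the combinatorial factor. Consequently the integrands of \<open>L\<^sub>k\<close> and \<open>M\<^sub>k\<close> are, up to
  the weight \<open>(\<theta>/2) / (\<xi>(1 - \<xi>))\<close>, the claimed right-hand sides with \<open>\<lambda>\<^sub>m\<close> replaced by \<open>(1 - u)\<^sup>m\<close> and
  \<open>\<mu>\<^sub>m\<^sub>,\<^sub>n\<close> by \<open>u\<^sup>m (1 - u)\<^sup>n\<close>. Their value at \<open>u = 0\<close> is \<open>J\<^sub>k\<close>, the logarithm is the integral of
  \<open>1 / (\<xi>(1 - \<xi>))\<close>, and after subtraction the singularity at \<open>\<xi> = 0\<close> cancels in each monomial, leaving
  convergent integrals equal to \<open>\<lambda>\<^sub>m\<close> and \<open>\<mu>\<^sub>m\<^sub>,\<^sub>n\<close>.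
\<close>

section \<open>Beta integrals\<close>

text \<open>Induction on \<open>p\<close> through
  \<open>(r - t)^(p+1) t^a = r (r - t)^p t^a - (r - t)^p t^(a+1)\<close>, which raises
  \<open>a\<close> and so needs it arbitrary. The value is the Beta function at integer arguments,
  scaled to \<open>{0..r}\<close>.\<close>

lemma has_integral_power_mult_power:
  fixes r :: real
  assumes "0 \<le> r"
  shows "((\<lambda>t. (r - t) ^ p * t ^ a) has_integral
           fact p * fact a / fact (p + a + 1) * r ^ (p + a + 1)) {0..r}"
proof (induction p arbitrary: a)
  case 0
  have "((\<lambda>t. t ^ a) has_integral (r ^ (a+1) / real (a+1) - 0 ^ (a+1) / real (a+1))) {0..r}"
    using assms
    by (intro fundamental_theorem_of_calculus)
       (auto intro!: derivative_eq_intros simp flip: has_real_derivative_iff_has_vector_derivative,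
        cases a, auto simp: field_simps)
  then show ?case by simp
next
  case (Suc p)
  have "((\<lambda>t. r * ((r - t) ^ p * t ^ a) - (r - t) ^ p * t ^ Suc a) has_integral
      r * (fact p * fact a / fact (p + a + 1) * r ^ (p + a + 1))
      - fact p * fact (Suc a) / fact (p + Suc a + 1) * r ^ (p + Suc a + 1)) {0..r}"
    by (intro has_integral_diff has_integral_mult_right Suc)
  also have "(\<lambda>t. r * ((r - t) ^ p * t ^ a) - (r - t) ^ p * t ^ Suc a)
      = (\<lambda>t. (r - t) ^ Suc p * t ^ a)"
    by (auto simp: algebra_simps)
  also have "r * (fact p * fact a / fact (p + a + 1) * r ^ (p + a + 1))
      - fact p * fact (Suc a) / fact (p + Suc a + 1) * r ^ (p + Suc a + 1)
      = fact (Suc p) * fact a / fact (Suc p + a + 1) * r ^ (Suc p + a + 1)"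
    by (simp add: divide_simps) (simp add: algebra_simps)
  finally show ?case .
qed

text \<open>An incomplete Beta integral over \<open>{u..v}\<close>, written as the integral over
  \<open>{0..v}\<close> minus the one over \<open>{0..u}\<close>. Only the latter is expanded
  binomially: the first term is free of \<open>u\<close> and leads to \<open>delta\<close>, the
  powers of \<open>u\<close> in the second lead to \<open>eps\<close> and
  \<open>zeta\<close>.\<close>

definition tailpow :: "nat \<Rightarrow> nat \<Rightarrow> real \<Rightarrow> real \<Rightarrow> real" where
  "tailpow p a u v = fact p * fact a / fact (p + a + 1) * v ^ (p + a + 1)
     - (\<Sum>q=0..p. (-1) ^ q * real (p choose q) * v ^ (p - q) * (u ^ (q + a + 1) / real (q + a + 1)))"

lemma has_integral_tailpow:
  fixes u v :: real
  assumes "0 \<le> u" "u \<le> v"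
  shows "((\<lambda>t. (v - t) ^ p * t ^ a) has_integral tailpow p a u v) {u..v}"
proof -
  let ?f = "\<lambda>t. (v - t) ^ p * t ^ a"
  let ?h = "\<Sum>q=0..p. (-1) ^ q * real (p choose q) * v ^ (p - q) * (u ^ (q + a + 1) / real (q + a + 1))"
  have pow: "((\<lambda>t. t ^ m) has_integral u ^ (m+1) / real (m+1)) {0..u}" for m
    using has_integral_power_mult_power[OF assms(1), of 0 m] by simp
  have "((\<lambda>t. \<Sum>q=0..p. (-1) ^ q * real (p choose q) * v ^ (p - q) * t ^ (q + a)) has_integral ?h) {0..u}"
    by (intro has_integral_sum has_integral_mult_right pow) auto
  also have "(\<lambda>t. \<Sum>q=0..p. (-1) ^ q * real (p choose q) * v ^ (p - q) * t ^ (q + a)) = ?f"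
  proof
    fix t
    have "(v - t) ^ p = (\<Sum>q=0..p. real (p choose q) * (-t) ^ q * v ^ (p - q))"
      using binomial_ring[of "-t" v p] by (simp add: atLeast0AtMost)
    then show "(\<Sum>q=0..p. (-1) ^ q * real (p choose q) * v ^ (p - q) * t ^ (q + a)) = ?f t"
      by (simp add: sum_distrib_left sum_distrib_right power_add power_minus[of t] mult_ac)
  qed
  finally have h: "(?f has_integral ?h) {0..u}" .
  have g: "(?f has_integral fact p * fact a / fact (p + a + 1) * v ^ (p + a + 1)) {0..v}"
    using has_integral_power_mult_power[of v p a] assms by simp
  have i: "?f integrable_on {u..v}"
    by (intro integrable_continuous_interval continuous_intros)
  have "integral {0..u} ?f + integral {u..v} ?f = integral {0..v} ?f"
    using g assms by (intro Henstock_Kurzweil_Integration.integral_combine) auto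
  then have "integral {u..v} ?f = tailpow p a u v"
    using integral_unique[OF g] integral_unique[OF h] by (simp add: tailpow_def)
  then show ?thesis
    using i by (simp add: has_integral_integrable_integral)
qed

section \<open>Iterated integrals\<close>

text \<open>
  \<open>iint\<close> is additive only where every nested integral exists, so existence is recorded at each level.
\<close>

fun has_iint :: "nat list \<Rightarrow> ((nat \<Rightarrow> real) \<Rightarrow> real) \<Rightarrow> (nat \<Rightarrow> real) \<Rightarrow> real \<Rightarrow> bool" where
  "has_iint [] g y v \<longleftrightarrow> v = g y"
| "has_iint (i # is) g y v \<longleftrightarrow>
     (\<exists>h. (\<forall>t\<in>{0..1}. has_iint is g (y(i := t)) (h t)) \<and> (h has_integral v) {0..1})"

lemma has_iint_ConsI:
  assumes "\<And>t. 0 \<le> t \<Longrightarrow> t \<le> 1 \<Longrightarrow> has_iint is g (y(i := t)) (h t)" "(h has_integral v) {0..1}"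
  shows "has_iint (i # is) g y v"
  using assms unfolding has_iint.simps by (intro exI[of _ h]) auto

lemma has_iint_imp_iint: "has_iint is g y v \<Longrightarrow> iint is g y = v"
proof (induction "is" arbitrary: y v)
  case (Cons i "is")
  then obtain h where h: "\<forall>t\<in>{0..1}. has_iint is g (y(i := t)) (h t)" "(h has_integral v) {0..1}"
    by auto
  have "integral {0..1} (\<lambda>t. iint is g (y(i := t))) = integral {0..1} h"
    using h(1) Cons.IH by (intro integral_cong) blast
  with h(2) show ?case by auto
qed simp

text \<open>Comparing the integrands only at such points gives access to the value of a coordinate
  fixed at an outer level and to the nonnegativity of the integration variables.\<close>

lemma has_iint_cong:
  assumes "has_iint is g y v"
    and "\<And>y'. (\<And>j. j \<notin> set is \<Longrightarrow> y' j = y j) \<Longrightarrow> (\<And>j. j \<in> set is \<Longrightarrow> 0 \<le> y' j \<and> y' j \<le> 1)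
            \<Longrightarrow> g y' = g' y'"
  shows "has_iint is g' y v"
  using assms
proof (induction "is" arbitrary: y v)
  case (Cons i "is")
  then obtain h where h: "\<forall>t\<in>{0..1}. has_iint is g (y(i := t)) (h t)" "(h has_integral v) {0..1}"
    by auto
  have "has_iint is g' (y(i := t)) (h t)" if t: "t \<in> {0..1}" for t
  proof (rule Cons.IH)
    show "has_iint is g (y(i := t)) (h t)" using h t by auto
    fix y' assume 1: "\<And>j. j \<notin> set is \<Longrightarrow> y' j = (y(i := t)) j"
      and 2: "\<And>j. j \<in> set is \<Longrightarrow> 0 \<le> y' j \<and> y' j \<le> 1"
    show "g y' = g' y'"
    proof (rule Cons.prems(2))
      fix j assume "j \<notin> set (i # is)"
      then show "y' j = y j" using 1[of j] by simp
    next
      fix j assume "j \<in> set (i # is)"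
      then show "0 \<le> y' j \<and> y' j \<le> 1"
        using 1[of j] 2[of j] t by (cases "j \<in> set is") auto
    qed
  qed
  then show ?case using h(2) by (intro has_iint_ConsI) auto
qed simp

lemma has_iint_add:
  "has_iint is f y v \<Longrightarrow> has_iint is g y w \<Longrightarrow> has_iint is (\<lambda>y. f y + g y) y (v + w)"
proof (induction "is" arbitrary: y v w)
  case (Cons i "is")
  obtain h h' where "\<forall>t\<in>{0..1}. has_iint is f (y(i := t)) (h t)" "(h has_integral v) {0..1}"
    "\<forall>t\<in>{0..1}. has_iint is g (y(i := t)) (h' t)" "(h' has_integral w) {0..1}"
    using Cons.prems by auto
  then show ?case
    by (intro has_iint_ConsI[where h = "\<lambda>t. h t + h' t"] Cons.IH has_integral_add) (auto simp del: fun_upd_apply)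
qed simp

lemma has_iint_cmult:
  "has_iint is f y v \<Longrightarrow> has_iint is (\<lambda>y. a * f y) y (a * v)"
proof (induction "is" arbitrary: y v)
  case (Cons i "is")
  obtain h where "\<forall>t\<in>{0..1}. has_iint is f (y(i := t)) (h t)" "(h has_integral v) {0..1}"
    using Cons.prems by auto
  then show ?case
    by (intro has_iint_ConsI[where h = "\<lambda>t. a * h t"] Cons.IH has_integral_mult_right) (auto simp del: fun_upd_apply)
qed simp

lemma has_iint_diff:
  assumes "has_iint is f y v" "has_iint is g y w"
  shows "has_iint is (\<lambda>y. f y - g y) y (v - w)"
  using has_iint_add[OF assms(1) has_iint_cmult[OF assms(2), of "-1"]] by simp

lemma has_iint_zero: "has_iint is (\<lambda>y. 0) y 0"
proof (induction "is" arbitrary: y)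
  case (Cons i "is")
  then show ?case by (intro has_iint_ConsI[where h = "\<lambda>_. 0"]) auto
qed simp

lemma has_iint_sum:
  assumes "\<And>i. i \<in> A \<Longrightarrow> has_iint is (f i) y (v i)"
  shows "has_iint is (\<lambda>y. \<Sum>i\<in>A. f i y) y (\<Sum>i\<in>A. v i)"
  using assms by (induction A rule: infinite_finite_induct) (auto intro!: has_iint_add has_iint_zero)

section \<open>Moments over the simplex\<close>

definition compositions :: "nat \<Rightarrow> nat \<Rightarrow> nat list set" where
  "compositions r c = {cs. length cs = r \<and> (\<forall>cj\<in>set cs. 1 \<le> cj) \<and> sum_list cs = c}"

lemma finite_compositions: "finite (compositions r c)"
proof (rule finite_subset)
  show "compositions r c \<subseteq> {cs. set cs \<subseteq> {..c} \<and> length cs = r}"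
    by (auto simp: compositions_def intro: member_le_sum_list)
qed (simp add: finite_lists_length_eq)

text \<open>The coefficient of \<open>z^c\<close> in \<open>A(z)^r\<close>, where
  \<open>A(z)\<close> is the formal series with coefficients \<open>(2j)!/j!\<close> for
  \<open>j >= 1\<close>; thus \<open>Qc c x / c!\<close> is the coefficient of \<open>z^c\<close> in
  \<open>(1 + A(z))^x\<close>.\<close>

definition compsum :: "nat \<Rightarrow> nat \<Rightarrow> real" where
  "compsum r c = (\<Sum>cs\<in>compositions r c. \<Prod>cj\<leftarrow>cs. fact (2*cj) / fact cj)"

lemma compsum_0: "compsum 0 c = (if c = 0 then 1 else 0)"
proof -
  have "compositions 0 c = (if c = 0 then {[]} else {})"
    by (auto simp: compositions_def)
  then show ?thesis by (simp add: compsum_def)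
qed

lemma compsum_eq_0:
  assumes "c < r"
  shows "compsum r c = 0"
proof -
  have le: "length cs \<le> sum_list cs" if "\<forall>cj\<in>set cs. 1 \<le> cj" for cs :: "nat list"
    using that by (induction cs) auto
  have "compositions r c = {}"
    using le assms by (fastforce simp: compositions_def)
  then show ?thesis by (simp add: compsum_def)
qed

text \<open>The first part \<open>j\<close> is split off, which leaves a composition of
  \<open>c - j\<close> into \<open>r\<close> parts.\<close>

lemma compsum_Suc:
  "compsum (Suc r) c = (\<Sum>j=1..c. fact (2*j) / fact j * compsum r (c - j))"
proof -
  let ?w = "\<lambda>cs. \<Prod>cj\<leftarrow>cs. (fact (2*cj) / fact cj :: real)"
  have "bij_betw (\<lambda>(j, cs). j # cs) (SIGMA j:{1..c}. compositions r (c - j)) (compositions (Suc r) c)"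
  proof (rule bij_betwI[where g = "\<lambda>cs. (hd cs, tl cs)"])
    show "(\<lambda>cs. (hd cs, tl cs)) \<in> compositions (Suc r) c \<rightarrow> (SIGMA j:{1..c}. compositions r (c - j))"
    proof
      fix cs assume "cs \<in> compositions (Suc r) c"
      then show "(hd cs, tl cs) \<in> (SIGMA j:{1..c}. compositions r (c - j))"
        by (cases cs) (auto simp: compositions_def)
    qed
  qed (auto simp: compositions_def length_Suc_conv)
  then have "compsum (Suc r) c = (\<Sum>(j, cs)\<in>(SIGMA j:{1..c}. compositions r (c - j)). ?w (j # cs))"
    unfolding compsum_def by (simp add: sum.reindex_bij_betw[symmetric] case_prod_unfold)
  also have "\<dots> = (\<Sum>j=1..c. \<Sum>cs\<in>compositions r (c - j). ?w (j # cs))"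
    by (rule sum.Sigma[symmetric]) (auto simp: finite_compositions)
  finally show ?thesis
    by (simp add: compsum_def sum_distrib_left)
qed

text \<open>Terms with \<open>r > c\<close> vanish, and the term \<open>r = 0\<close> is
  \<open>1\<close> or \<open>0\<close> according to whether \<open>c = 0\<close>. One range of
  \<open>r\<close> therefore serves all \<open>c \<le> R\<close>, without the case distinction in
  \<open>Qc\<close>.\<close>

lemma Qc_eq_compsum:
  assumes "c \<le> R"
  shows "Qc c x = fact c * (\<Sum>r\<le>R. (x gchoose r) * compsum r c)"
proof -
  have "(\<Sum>r\<le>R. (x gchoose r) * compsum r c) = (\<Sum>r\<le>c. (x gchoose r) * compsum r c)"
    using assms by (intro sum.mono_neutral_right) (auto simp: compsum_eq_0)
  also have "\<dots> = (x gchoose 0) * compsum 0 c + (\<Sum>r=1..c. (x gchoose r) * compsum r c)"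
    by (simp add: sum.atLeast_Suc_atMost flip: atLeast0AtMost)
  moreover have "Qc c x = (if c = 0 then 1 else fact c * (\<Sum>r=1..c. (x gchoose r) * compsum r c))"
    by (simp only: Qc_def compsum_def compositions_def)
  ultimately show ?thesis
    by (simp add: compsum_0)
qed

lemma Qc_0_right: "Qc c 0 = (if c = 0 then 1 else 0)"
  by (auto simp: Qc_def gbinomial_0_left)

text \<open>Splitting off one variable: the sum over \<open>m\<close> distributes the exponent between it and the others.\<close>

lemma Qc_add_1:
  "Qc n (x + 1) = (\<Sum>m\<le>n. real (n choose m) * fact (2 * (n - m)) * Qc m x)"
proof -
  let ?E = "\<lambda>c. \<Sum>r\<le>n. (x gchoose r) * compsum r c"
  have Q: "Qc m x = fact m * ?E m" if "m \<le> n" for m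
    using that by (rule Qc_eq_compsum)
  \<comment> \<open>Bounding \<open>r\<close> by \<open>Suc n\<close> leaves the range
    \<open>r \<le> n\<close> after the index shift, where Pascal's rule applies to each
    coefficient.\<close>
  have "(\<Sum>r\<le>Suc n. ((x + 1) gchoose r) * compsum r n)
      = compsum 0 n + (\<Sum>r\<le>n. ((x gchoose r) + (x gchoose Suc r)) * compsum (Suc r) n)"
    by (subst sum.atMost_Suc_shift) (simp add: gbinomial_Suc_Suc)
  also have "\<dots> = (compsum 0 n + (\<Sum>r\<le>n. (x gchoose Suc r) * compsum (Suc r) n))
                 + (\<Sum>r\<le>n. (x gchoose r) * compsum (Suc r) n)"
    by (simp add: algebra_simps sum.distrib)
  also have "compsum 0 n + (\<Sum>r\<le>n. (x gchoose Suc r) * compsum (Suc r) n)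
      = (\<Sum>r\<le>Suc n. (x gchoose r) * compsum r n)"
    by (simp add: sum.atMost_Suc_shift del: sum.atMost_Suc)
  also have "\<dots> = ?E n" by (simp add: compsum_eq_0)
  also have "(\<Sum>r\<le>n. (x gchoose r) * compsum (Suc r) n)
      = (\<Sum>j=1..n. fact (2*j) / fact j * ?E (n - j))"
    unfolding compsum_Suc sum_distrib_left
    by (subst sum.swap) (simp add: mult_ac)
  \<comment> \<open>\<open>?E n\<close> is the missing term \<open>j = 0\<close>, since
    \<open>(2*0)!/0! = 1\<close>.\<close>
  also have "?E n + \<dots> = (\<Sum>j=0..n. fact (2*j) / fact j * ?E (n - j))"
    by (simp add: sum.atLeast_Suc_atMost[of 0 n])
  also have "\<dots> = (\<Sum>m\<le>n. fact (2*(n-m)) / fact (n - m) * ?E m)"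
    by (rule sum.reindex_bij_witness[of _ "\<lambda>m. n - m" "\<lambda>m. n - m"]) auto
  finally have "Qc n (x + 1) = (\<Sum>m\<le>n. fact n * (fact (2*(n-m)) / fact (n - m) * ?E m))"
    using Qc_eq_compsum[of n "Suc n" "x + 1"] by (simp add: sum_distrib_left)
  also have "\<dots> = (\<Sum>m\<le>n. real (n choose m) * fact (2 * (n - m)) * Qc m x)"
    by (intro sum.cong) (auto simp: Q binomial_fact)
  finally show ?thesis .
qed

section \<open>Dirichlet-type moments of a truncated simplex\<close>

lemma has_integral_truncated_power:
  fixes \<sigma> :: real
  assumes "\<sigma> \<le> 1"
  shows "((\<lambda>t. if t \<le> \<sigma> then (\<sigma> - t) ^ p * t ^ a else 0) has_integral
     (if 0 \<le> \<sigma> then fact p * fact a / fact (p + a + 1) * \<sigma> ^ (p + a + 1) else 0)) {0..1}"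
proof (cases "0 \<le> \<sigma>")
  case True
  let ?f = "\<lambda>t. (\<sigma> - t) ^ p * t ^ a"
  have "((\<lambda>t. if t \<in> {0..\<sigma>} then ?f t else 0) has_integral
          fact p * fact a / fact (p + a + 1) * \<sigma> ^ (p + a + 1)) {0..1}"
    using has_integral_power_mult_power[OF True] assms by (subst has_integral_restrict) auto
  then show ?thesis using True by (subst has_integral_cong[where g = "\<lambda>t. if t \<in> {0..\<sigma>} then ?f t else 0"]) auto
qed (auto intro!: has_integral_is_0)

text \<open>A Dirichlet integral over the simplex of size \<open>\<sigma>\<close>, one variable at a
  time. Fixing a variable at \<open>t\<close> replaces \<open>\<sigma>\<close> by
  \<open>\<sigma> - t\<close>, possibly negative, whence the case distinction. Binomial expansion of
  the sum of squares gives Beta integrals, and \<open>Qc_add_1\<close> collects them.\<close>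

lemma has_iint_truncated_power:
  assumes "distinct is" "\<sigma> \<le> 1"
  shows "has_iint is (\<lambda>y. if (\<Sum>i\<in>set is. y i) \<le> \<sigma>
             then (\<sigma> - (\<Sum>i\<in>set is. y i)) ^ p * (\<Sum>i\<in>set is. (y i)\<^sup>2) ^ n else 0) y
           (if 0 \<le> \<sigma> then Qc n (real (length is)) * fact p / fact (p + length is + 2*n)
                           * \<sigma> ^ (p + length is + 2*n) else 0)"
  using assms
proof (induction "is" arbitrary: y \<sigma> n)
  case Nil
  \<comment> \<open>Without variables the integrand contains \<open>0 ^ n\<close>, which matches
    \<open>Qc n 0\<close>.\<close>
  then show ?case by (auto simp: Qc_0_right)
next
  case (Cons i "is")
  let ?N = "length is"
  let ?S = "\<lambda>y. \<Sum>i\<in>set is. y i :: real" and ?P = "\<lambda>y. \<Sum>i\<in>set is. (y i)\<^sup>2 :: real"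
  let ?C = "\<lambda>m. Qc m (real ?N) * fact p / fact (p + ?N + 2*m)"
  let ?v = "\<lambda>\<sigma> m. if 0 \<le> \<sigma> then ?C m * \<sigma> ^ (p + ?N + 2*m) else 0"
  let ?h = "\<lambda>t. \<Sum>m\<le>n. real (n choose m) * t ^ (2*(n-m)) * ?v (\<sigma> - t) m"
  have i: "i \<notin> set is" "distinct is" using Cons.prems by auto
  show ?case
  proof (rule has_iint_ConsI[where h = ?h])
    fix t :: real assume t: "0 \<le> t" "t \<le> 1"
    have "has_iint is (\<lambda>y. \<Sum>m\<le>n. real (n choose m) * t ^ (2*(n-m)) *
             (if ?S y \<le> \<sigma> - t then (\<sigma> - t - ?S y) ^ p * ?P y ^ m else 0)) (y(i := t)) (?h t)"
      using Cons.prems t by (intro has_iint_sum has_iint_cmult Cons.IH i) auto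
    then show "has_iint is (\<lambda>y. if (\<Sum>i\<in>set (i # is). y i) \<le> \<sigma>
             then (\<sigma> - (\<Sum>i\<in>set (i # is). y i)) ^ p * (\<Sum>i\<in>set (i # is). (y i)\<^sup>2) ^ n else 0)
             (y(i := t)) (?h t)"
    proof (rule has_iint_cong)
      fix y' assume y': "\<And>j. j \<notin> set is \<Longrightarrow> y' j = (y(i := t)) j"
      have t': "y' i = t" using y'[of i] i by simp
      have "(t\<^sup>2 + ?P y') ^ n = (\<Sum>m\<le>n. real (n choose m) * t ^ (2*(n-m)) * ?P y' ^ m)"
        by (subst add.commute, subst binomial_ring) (simp add: mult_ac flip: power_mult)
      then show "(\<Sum>m\<le>n. real (n choose m) * t ^ (2*(n-m)) *
             (if ?S y' \<le> \<sigma> - t then (\<sigma> - t - ?S y') ^ p * ?P y' ^ m else 0)) =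
          (if (\<Sum>i\<in>set (i # is). y' i) \<le> \<sigma>
             then (\<sigma> - (\<Sum>i\<in>set (i # is). y' i)) ^ p * (\<Sum>i\<in>set (i # is). (y' i)\<^sup>2) ^ n else 0)"
        using i t' by (auto simp: sum_distrib_left algebra_simps diff_diff_eq)
    qed
  next
    have "((\<lambda>t. \<Sum>m\<le>n. real (n choose m) * ?C m *
             (if t \<le> \<sigma> then (\<sigma> - t) ^ (p + ?N + 2*m) * t ^ (2*(n-m)) else 0)) has_integral
           (\<Sum>m\<le>n. real (n choose m) * ?C m *
             (if 0 \<le> \<sigma> then fact (p + ?N + 2*m) * fact (2*(n-m)) / fact ((p + ?N + 2*m) + 2*(n-m) + 1)
                  * \<sigma> ^ ((p + ?N + 2*m) + 2*(n-m) + 1) else 0))) {0..1}"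
      using Cons.prems by (intro has_integral_sum has_integral_mult_right has_integral_truncated_power) auto
    also have "(\<lambda>t. \<Sum>m\<le>n. real (n choose m) * ?C m *
             (if t \<le> \<sigma> then (\<sigma> - t) ^ (p + ?N + 2*m) * t ^ (2*(n-m)) else 0)) = ?h"
      by (intro ext sum.cong) auto
    \<comment> \<open>\<open>fact (p + ?N + 2*m)\<close> cancels and the exponent of
      \<open>\<sigma>\<close> no longer depends on \<open>m\<close>, so that exactly the sum of
      \<open>Qc_add_1\<close> remains.\<close>
    also have "(\<Sum>m\<le>n. real (n choose m) * ?C m *
             (if 0 \<le> \<sigma> then fact (p + ?N + 2*m) * fact (2*(n-m)) / fact ((p + ?N + 2*m) + 2*(n-m) + 1)
                  * \<sigma> ^ ((p + ?N + 2*m) + 2*(n-m) + 1) else 0))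
        = (\<Sum>m\<le>n. real (n choose m) * fact (2 * (n - m)) * Qc m (real ?N) *
             (if 0 \<le> \<sigma> then fact p / fact (p + Suc ?N + 2*n) * \<sigma> ^ (p + Suc ?N + 2*n) else 0))"
    proof (intro sum.cong refl)
      fix m assume "m \<in> {..n}"
      then have "(p + ?N + 2*m) + 2*(n-m) + 1 = p + Suc ?N + 2*n" by auto
      then show "real (n choose m) * ?C m *
             (if 0 \<le> \<sigma> then fact (p + ?N + 2*m) * fact (2*(n-m)) / fact ((p + ?N + 2*m) + 2*(n-m) + 1)
                  * \<sigma> ^ ((p + ?N + 2*m) + 2*(n-m) + 1) else 0) =
          real (n choose m) * fact (2 * (n - m)) * Qc m (real ?N) *
             (if 0 \<le> \<sigma> then fact p / fact (p + Suc ?N + 2*n) * \<sigma> ^ (p + Suc ?N + 2*n) else 0)"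
        by (simp add: field_simps)
    qed
    also have "\<dots> = Qc n (real (length (i # is))) *
             (if 0 \<le> \<sigma> then fact p / fact (p + Suc ?N + 2*n) * \<sigma> ^ (p + Suc ?N + 2*n) else 0)"
      using Qc_add_1[of n "real ?N"] by (simp add: sum_distrib_right add.commute)
    finally show "(?h has_integral (if 0 \<le> \<sigma> then Qc n (real (length (i # is))) * fact p / fact (p + length (i # is) + 2*n)
                           * \<sigma> ^ (p + length (i # is) + 2*n) else 0)) {0..1}"
      by (simp add: mult.assoc split: if_splits)
  qed
qed

text \<open>Both sides evaluate the integral of \<open>(1 - s)^p s^(M - 1)\<close> over
  \<open>{0..r}\<close>: the left one expands \<open>1 - s = (r - s) + (1 - r)\<close>, the right
  one expands in powers of \<open>s\<close>.\<close>

lemma truncated_moment_eq: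
  fixes r :: real
  assumes "0 \<le> r" "0 < M"
  shows "(\<Sum>l\<le>p. real (p choose l) * (1 - r) ^ (p - l) * (fact l * fact (M - 1) / fact (l + M) * r ^ (l + M)))
       = (\<Sum>d=0..p. (-1) ^ d * real (p choose d) * r ^ (M + d) / real (M + d))"
proof (rule has_integral_unique)
  let ?f = "\<lambda>s. (1 - s) ^ p * s ^ (M - 1)"
  have "((\<lambda>s. \<Sum>l\<le>p. real (p choose l) * (1 - r) ^ (p - l) * ((r - s) ^ l * s ^ (M - 1))) has_integral
      (\<Sum>l\<le>p. real (p choose l) * (1 - r) ^ (p - l) * (fact l * fact (M - 1) / fact (l + (M - 1) + 1) * r ^ (l + (M - 1) + 1)))) {0..r}"
    by (intro has_integral_sum has_integral_mult_right has_integral_power_mult_power assms) auto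
  also have "(\<lambda>s. \<Sum>l\<le>p. real (p choose l) * (1 - r) ^ (p - l) * ((r - s) ^ l * s ^ (M - 1))) = ?f"
  proof
    fix s
    have "(1 - s) ^ p = (\<Sum>l\<le>p. real (p choose l) * (r - s) ^ l * (1 - r) ^ (p - l))"
      using binomial_ring[of "r - s" "1 - r" p] by simp
    then show "(\<Sum>l\<le>p. real (p choose l) * (1 - r) ^ (p - l) * ((r - s) ^ l * s ^ (M - 1))) = ?f s"
      by (simp add: sum_distrib_left sum_distrib_right mult_ac)
  qed
  finally show "(?f has_integral (\<Sum>l\<le>p. real (p choose l) * (1 - r) ^ (p - l) * (fact l * fact (M - 1) / fact (l + M) * r ^ (l + M)))) {0..r}"
    using assms by simp
  have pow: "((\<lambda>t. t ^ m) has_integral r ^ (m+1) / real (m+1)) {0..r}" for m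
    using has_integral_power_mult_power[OF assms(1), of 0 m] by simp
  have "((\<lambda>s. \<Sum>d=0..p. (-1) ^ d * real (p choose d) * s ^ (M - 1 + d)) has_integral
      (\<Sum>d=0..p. (-1) ^ d * real (p choose d) * (r ^ (M - 1 + d + 1) / real (M - 1 + d + 1)))) {0..r}"
    by (intro has_integral_sum has_integral_mult_right pow) auto
  also have "(\<lambda>s. \<Sum>d=0..p. (-1) ^ d * real (p choose d) * s ^ (M - 1 + d)) = ?f"
  proof
    fix s :: real
    have "(1 - s) ^ p = (\<Sum>d=0..p. real (p choose d) * (-s) ^ d)"
      using binomial_ring[of "-s" 1 p] by (simp add: atLeast0AtMost)
    then show "(\<Sum>d=0..p. (-1) ^ d * real (p choose d) * s ^ (M - 1 + d)) = ?f s"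
      by (simp add: sum_distrib_left sum_distrib_right power_add power_minus[of s] mult_ac)
  qed
  finally show "(?f has_integral (\<Sum>d=0..p. (-1) ^ d * real (p choose d) * r ^ (M + d) / real (M + d))) {0..r}"
    using assms by simp
qed

text \<open>With \<open>S\<close> the sum of the variables, expanding
  \<open>1 - S = (r - S) + (1 - r)\<close> reduces to \<open>has_iint_truncated_power\<close>;
  \<open>truncated_moment_eq\<close> then gives the alternating sum in the shape of the
  theorem.\<close>

lemma has_iint_truncated_moment:
  fixes r :: real and n p :: nat
  assumes "distinct is" "is \<noteq> []" "0 \<le> r" "r \<le> 1"
  defines "M \<equiv> length is + 2 * n"
  shows "has_iint is (\<lambda>y. if (\<Sum>i\<in>set is. y i) \<le> r
             then (1 - (\<Sum>i\<in>set is. y i)) ^ p * (\<Sum>i\<in>set is. (y i)\<^sup>2) ^ n else 0) y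
           (Qc n (real (length is)) / fact (M - 1) *
             (\<Sum>d=0..p. (-1) ^ d * real (p choose d) * r ^ (M + d) / real (M + d)))"
proof -
  let ?S = "\<lambda>y. \<Sum>i\<in>set is. y i :: real" and ?P = "\<lambda>y. \<Sum>i\<in>set is. (y i)\<^sup>2 :: real"
  have M: "0 < M" using assms by (simp add: M_def)
  have "has_iint is (\<lambda>y. \<Sum>l\<le>p. real (p choose l) * (1 - r) ^ (p - l) *
            (if ?S y \<le> r then (r - ?S y) ^ l * ?P y ^ n else 0)) y
       (\<Sum>l\<le>p. real (p choose l) * (1 - r) ^ (p - l) * (if 0 \<le> r then Qc n (real (length is)) * fact l / fact (l + length is + 2*n)
                           * r ^ (l + length is + 2*n) else 0))"
    by (intro has_iint_sum has_iint_cmult has_iint_truncated_power assms)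
  also have "(\<lambda>y. \<Sum>l\<le>p. real (p choose l) * (1 - r) ^ (p - l) *
            (if ?S y \<le> r then (r - ?S y) ^ l * ?P y ^ n else 0)) =
     (\<lambda>y. if ?S y \<le> r then (1 - ?S y) ^ p * ?P y ^ n else 0)"
  proof
    fix y
    have "(1 - ?S y) ^ p = (\<Sum>l\<le>p. real (p choose l) * (r - ?S y) ^ l * (1 - r) ^ (p - l))"
      using binomial_ring[of "r - ?S y" "1 - r" p] by simp
    then show "(\<Sum>l\<le>p. real (p choose l) * (1 - r) ^ (p - l) *
            (if ?S y \<le> r then (r - ?S y) ^ l * ?P y ^ n else 0)) =
        (if ?S y \<le> r then (1 - ?S y) ^ p * ?P y ^ n else 0)"
      by (simp add: sum_distrib_left sum_distrib_right mult_ac)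
  qed
  also have "(\<Sum>l\<le>p. real (p choose l) * (1 - r) ^ (p - l) * (if 0 \<le> r then Qc n (real (length is)) * fact l / fact (l + length is + 2*n)
                           * r ^ (l + length is + 2*n) else 0))
     = Qc n (real (length is)) / fact (M - 1) *
        (\<Sum>l\<le>p. real (p choose l) * (1 - r) ^ (p - l) * (fact l * fact (M - 1) / fact (l + M) * r ^ (l + M)))"
    using assms by (simp add: sum_distrib_left M_def add_ac field_simps)
  finally show ?thesis
    unfolding truncated_moment_eq[OF assms(3) M] .
qed

section \<open>The right-hand sides as linear functionals\<close>

text \<open>
  \<open>Dsum\<close>, \<open>Esum\<close> and \<open>Fsum\<close> with arbitrary sequences \<open>\<phi>\<close>, \<open>\<psi>\<close> in place of \<open>\<lambda>\<close>, \<open>\<mu>\<close>.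
\<close>

definition Dgen :: "nat \<Rightarrow> (nat \<Rightarrow> nat) \<Rightarrow> (nat \<Rightarrow> nat) \<Rightarrow> nat \<Rightarrow> nat \<Rightarrow> nat \<Rightarrow> nat \<Rightarrow> (nat \<Rightarrow> real) \<Rightarrow> real" where
  "Dgen k b c i j c1 c2 \<phi> =
     (let dt = b i + b j + 2*c i + 2*c j - 2*c1 - 2*c2 + 2 in
      \<Sum>d1=0..dt. (-1::real)^d1 * real (dt choose d1) * delta b c i j c1 c2
          * \<phi> (k - 1 + d1 + 2*c1 + 2*c2)
        / (fact (k + 2*c1 + 2*c2 - 2) * real (k - 1 + 2*c1 + 2*c2 + d1)))"

definition Egen :: "nat \<Rightarrow> (nat \<Rightarrow> nat) \<Rightarrow> (nat \<Rightarrow> nat) \<Rightarrow> nat \<Rightarrow> nat \<Rightarrow> nat \<Rightarrow> nat \<Rightarrow> (nat \<Rightarrow> nat \<Rightarrow> real) \<Rightarrow> real" where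
  "Egen k b c i j c1 c2 \<psi> =
     (\<Sum>b1=0..b i. let et = b i - b1 + b j + 2*c j - 2*c2 + 1 in
      \<Sum>e1=0..et. (-1::real)^(e1 + b1) * real (et choose e1) * real (b i choose b1)
          * eps b c i j c1 c2 b1 * \<psi> (b1 + 2*c i - 2*c1 + 1) (k - 1 + e1 + 2*c1 + 2*c2)
        / (fact (k + 2*c1 + 2*c2 - 2) * real (k - 1 + 2*c1 + 2*c2 + e1)))"

definition Fgen :: "nat \<Rightarrow> (nat \<Rightarrow> nat) \<Rightarrow> (nat \<Rightarrow> nat) \<Rightarrow> nat \<Rightarrow> nat \<Rightarrow> nat \<Rightarrow> nat \<Rightarrow> (nat \<Rightarrow> nat \<Rightarrow> real) \<Rightarrow> real" where
  "Fgen k b c i j c1 c2 \<psi> =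
     (\<Sum>b1=0..b i. \<Sum>b2=0..b j. let ft = b i + b j - b1 - b2 in
      \<Sum>f1=0..ft. (-1::real)^(f1 + b1 + b2) * real (ft choose f1) * real (b i choose b1)
          * real (b j choose b2)
          * \<psi> (2*c i + 2*c j - 2*c1 - 2*c2 + b1 + b2 + 2) (k - 1 + f1 + 2*c1 + 2*c2)
        / (zeta b c i j c1 c2 b1 b2 * fact (k + 2*c1 + 2*c2 - 2) * real (k - 1 + 2*c1 + 2*c2 + f1)))"

definition quadsum :: "nat \<Rightarrow> nat \<Rightarrow> (nat \<Rightarrow> real) \<Rightarrow> (nat \<Rightarrow> nat) \<Rightarrow> (nat \<Rightarrow> nat \<Rightarrow> nat \<Rightarrow> nat \<Rightarrow> real) \<Rightarrow> real" where
  "quadsum k s a c X =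
     (\<Sum>i=0..s. \<Sum>j=0..s. a i * a j *
        (\<Sum>c1=0..c i. \<Sum>c2=0..c j. real (c i choose c1) * real (c j choose c2)
            * Qc (c1 + c2) (real (k - 1)) * X i j c1 c2))"

definition Lgen where
  "Lgen k s a b c \<phi> \<psi> = quadsum k s a c (\<lambda>i j c1 c2. Dgen k b c i j c1 c2 \<phi> - Egen k b c i j c1 c2 \<psi>)"

definition Mgen where
  "Mgen k s a b c \<phi> \<psi> = quadsum k s a c (\<lambda>i j c1 c2. Dgen k b c i j c1 c2 \<phi>
      - 2 * Egen k b c i j c1 c2 \<psi> + Fgen k b c i j c1 c2 \<psi>)"

lemma Ltilde_formula_eq: "Ltilde_formula k \<theta> s a b c = Lgen k s a b c (lam \<theta>) (mu \<theta>)"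
  unfolding Ltilde_formula_def Lgen_def quadsum_def Dsum_def Dgen_def Esum_def Egen_def by (rule refl)

lemma Mtilde_formula_eq: "Mtilde_formula k \<theta> s a b c = \<theta>/2 * Mgen k s a b c (lam \<theta>) (mu \<theta>)"
  unfolding Mtilde_formula_def Mgen_def quadsum_def Dsum_def Dgen_def Esum_def Egen_def
    Fsum_def Fgen_def by (rule refl)

text \<open>
  Finite linear combinations of the values \<open>\<phi> m\<close> and \<open>\<psi> m n\<close> at positive indices. The right-hand sides of
  the theorem have this form in \<open>\<lambda>\<close> and \<open>\<mu>\<close>, so integrals and limits may be taken index by index.
\<close>

inductive lincomb :: "((nat \<Rightarrow> real) \<Rightarrow> (nat \<Rightarrow> nat \<Rightarrow> real) \<Rightarrow> real) \<Rightarrow> bool" where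
  lincomb_zero: "lincomb (\<lambda>\<phi> \<psi>. 0)"
| lincomb_fst: "0 < m \<Longrightarrow> lincomb (\<lambda>\<phi> \<psi>. \<phi> m)"
| lincomb_snd: "0 < m \<Longrightarrow> 0 < n \<Longrightarrow> lincomb (\<lambda>\<phi> \<psi>. \<psi> m n)"
| lincomb_add: "lincomb \<Lambda> \<Longrightarrow> lincomb \<Lambda>' \<Longrightarrow> lincomb (\<lambda>\<phi> \<psi>. \<Lambda> \<phi> \<psi> + \<Lambda>' \<phi> \<psi>)"
| lincomb_cmult: "lincomb \<Lambda> \<Longrightarrow> lincomb (\<lambda>\<phi> \<psi>. \<kappa> * \<Lambda> \<phi> \<psi>)"

lemma lincomb_diff:
  assumes "lincomb \<Lambda>" "lincomb \<Lambda>'"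
  shows "lincomb (\<lambda>\<phi> \<psi>. \<Lambda> \<phi> \<psi> - \<Lambda>' \<phi> \<psi>)"
  using lincomb_add[OF assms(1) lincomb_cmult[OF assms(2), of "-1"]] by simp

lemma lincomb_divide:
  assumes "lincomb \<Lambda>"
  shows "lincomb (\<lambda>\<phi> \<psi>. \<Lambda> \<phi> \<psi> / \<kappa>)"
  using lincomb_cmult[OF assms, of "1 / \<kappa>"] by simp

lemma lincomb_sum:
  assumes "\<And>i. i \<in> A \<Longrightarrow> lincomb (\<Lambda> i)"
  shows "lincomb (\<lambda>\<phi> \<psi>. \<Sum>i\<in>A. \<Lambda> i \<phi> \<psi>)"
  using assms by (induction A rule: infinite_finite_induct) (auto intro: lincomb_zero lincomb_add)

text \<open>Transports a relation checked at single indices to the whole combination. It serves to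
  separate from each weighted monomial the part that is singular at
  \<open>\<xi> = 0\<close>.\<close>

lemma lincomb_affine:
  assumes "lincomb \<Lambda>"
    and "\<And>m. 0 < m \<Longrightarrow> \<kappa> * \<phi> m = \<kappa>' * \<phi>' m + f m"
    and "\<And>m n. 0 < m \<Longrightarrow> 0 < n \<Longrightarrow> \<kappa> * \<psi> m n = \<kappa>' * \<psi>' m n + g m n"
  shows "\<kappa> * \<Lambda> \<phi> \<psi> = \<kappa>' * \<Lambda> \<phi>' \<psi>' + \<Lambda> f g"
  using assms(1)
proof induction
  case (lincomb_cmult \<Lambda> x)
  then have "x * (\<kappa> * \<Lambda> \<phi> \<psi>) = x * (\<kappa>' * \<Lambda> \<phi>' \<psi>' + \<Lambda> f g)" by simp
  then show ?case by (simp add: algebra_simps)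
qed (auto simp: assms algebra_simps)

text \<open>Serves the endpoint \<open>\<xi> = \<theta>/2\<close>, where \<open>1 - u = 0\<close>
  and its positive powers vanish.\<close>

lemma lincomb_eq_0:
  assumes "lincomb \<Lambda>" "\<And>m. 0 < m \<Longrightarrow> \<phi> m = 0" "\<And>m n. 0 < m \<Longrightarrow> 0 < n \<Longrightarrow> \<psi> m n = 0"
  shows "\<Lambda> \<phi> \<psi> = 0"
  using assms(1) by induction (auto simp: assms)

lemma lincomb_has_integral:
  assumes "lincomb \<Lambda>" "\<And>m. 0 < m \<Longrightarrow> ((\<lambda>x. f x m) has_integral \<phi> m) X"
    and "\<And>m n. 0 < m \<Longrightarrow> 0 < n \<Longrightarrow> ((\<lambda>x. g x m n) has_integral \<psi> m n) X"
  shows "((\<lambda>x. \<Lambda> (f x) (g x)) has_integral \<Lambda> \<phi> \<psi>) X"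
  using assms(1) by induction (auto intro!: has_integral_add has_integral_mult_right simp: assms)

text \<open>All indices are positive: those of \<open>\<phi>\<close> and the second ones of
  \<open>\<psi>\<close> contain \<open>k - 1 \<ge> 1\<close>, the first ones of
  \<open>\<psi>\<close> contain \<open>+ 1\<close>.\<close>

lemma lincomb_Lgen: "2 \<le> k \<Longrightarrow> lincomb (Lgen k s a b c)"
  unfolding Lgen_def[abs_def] quadsum_def Dgen_def Egen_def Let_def
  by (intro lincomb_sum lincomb_cmult lincomb_diff lincomb_divide lincomb_fst lincomb_snd) auto

lemma lincomb_Mgen: "2 \<le> k \<Longrightarrow> lincomb (Mgen k s a b c)"
  unfolding Mgen_def[abs_def] quadsum_def Dgen_def Egen_def Fgen_def Let_def
  by (intro lincomb_sum lincomb_add lincomb_cmult lincomb_diff lincomb_divide lincomb_fst lincomb_snd) auto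

section \<open>The inner integrals\<close>

abbreviation tsum :: "nat \<Rightarrow> (nat \<Rightarrow> real) \<Rightarrow> real" where
  "tsum k y \<equiv> \<Sum>j\<in>{2..k}. y j"

abbreviation tsq :: "nat \<Rightarrow> (nat \<Rightarrow> real) \<Rightarrow> real" where
  "tsq k y \<equiv> \<Sum>j\<in>{2..k}. (y j)\<^sup>2"

text \<open>For \<open>0 \<le> u \<le> 1 - tsum k y\<close> and nonnegative outer coordinates, the
  integral of \<open>F\<close> over the first coordinate from \<open>u\<close> to
  \<open>1 - tsum k y\<close>.\<close>

definition Gsum :: "nat \<Rightarrow> nat \<Rightarrow> (nat \<Rightarrow> real) \<Rightarrow> (nat \<Rightarrow> nat) \<Rightarrow> (nat \<Rightarrow> nat) \<Rightarrow> real \<Rightarrow> (nat \<Rightarrow> real) \<Rightarrow> real" where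
  "Gsum k s a b c u y = (\<Sum>i=0..s. a i * (\<Sum>c1=0..c i. real (c i choose c1) *
      (tailpow (b i) (2 * c i - 2 * c1) u (1 - tsum k y) * tsq k y ^ c1)))"

text \<open>In the first coordinate \<open>F\<close> is a polynomial cut off at
  \<open>1 - tsum k y\<close>; expanding \<open>(tsq k y + w^2)^n\<close> brings each term to the
  form integrated by \<open>tailpow\<close>.\<close>

lemma FF_upd_1:
  assumes "1 \<le> k" "0 \<le> w" "\<And>j. j \<in> {2..k} \<Longrightarrow> 0 \<le> y j"
  shows "FF k s a b c (y(1 := w)) = (if w \<le> 1 - tsum k y then
      (\<Sum>i=0..s. a i * (\<Sum>c1=0..c i. real (c i choose c1) *
         ((1 - tsum k y - w) ^ b i * w ^ (2 * c i - 2 * c1) * tsq k y ^ c1))) else 0)"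
proof -
  have set: "{1..k} = insert 1 {2..k}" using assms by auto
  have upd: "(\<Sum>i\<in>{2..k}. h ((y(1 := w)) i)) = (\<Sum>i\<in>{2..k}. h (y i))" for h :: "real \<Rightarrow> real"
    by (intro sum.cong) auto
  have p1: "P1 k (y(1 := w)) = w + tsum k y"
    unfolding P1_def set using upd[of "\<lambda>x. x"] by (simp del: fun_upd_apply) simp
  have p2: "P2 k (y(1 := w)) = tsq k y + w\<^sup>2"
    unfolding P2_def set using upd[of "\<lambda>x. x\<^sup>2"] by (simp del: fun_upd_apply) simp
  have R: "in_Rk k (y(1 := w)) \<longleftrightarrow> w \<le> 1 - tsum k y"
    unfolding in_Rk_def p1 set using assms by auto
  have "(tsq k y + w\<^sup>2) ^ n = (\<Sum>c1=0..n. real (n choose c1) * (w ^ (2 * n - 2 * c1) * tsq k y ^ c1))" for n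
    by (subst binomial_ring)
       (simp only: atLeast0AtMost power_mult[symmetric] diff_mult_distrib diff_mult_distrib2 mult_ac)
  then show ?thesis
    unfolding FF_def R Ppoly_def p1 p2
    by (simp add: sum_distrib_left diff_diff_eq mult.assoc mult.left_commute add.commute)
qed

text \<open>The substitution \<open>w = u + (1 - u) t\<close> carries
  \<open>{0..(v - u)/(1 - u)}\<close> onto \<open>{u..v}\<close>; \<open>v \<le> 1\<close> keeps the
  former inside \<open>{0..1}\<close>.\<close>

lemma has_integral_truncated_affine:
  fixes f :: "real \<Rightarrow> real"
  assumes "(f has_integral I) {u..v}" "u < 1" "u \<le> v" "v \<le> 1"
  shows "((\<lambda>t. if u + (1 - u) * t \<le> v then f (u + (1 - u) * t) else 0) has_integral 1 / (1 - u) * I) {0..1}"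
proof -
  let ?w = "(v - u) / (1 - u)"
  have "((\<lambda>t. f (u + (1 - u) * t)) has_integral 1 / (1 - u) * I) {0..?w}"
    using has_integral_affinity'[of f I u v "1 - u" u] assms
    by (simp add: add.commute[of u] divide_inverse_commute)
  then have "((\<lambda>t. if t \<in> {0..?w} then f (u + (1 - u) * t) else 0) has_integral 1 / (1 - u) * I) {0..1}"
    using assms by (subst has_integral_restrict) auto
  also have "?this \<longleftrightarrow> ((\<lambda>t. if u + (1 - u) * t \<le> v then f (u + (1 - u) * t) else 0) has_integral 1 / (1 - u) * I) {0..1}"
    using assms by (intro has_integral_cong) (auto simp: pos_le_divide_eq algebra_simps)
  finally show ?thesis .
qed

text \<open>If \<open>tsum k y > 1 - u\<close>, the argument \<open>u + (1 - u) t \<ge> u\<close>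
  lies beyond the cut-off for every \<open>t\<close>; otherwise the affine substitution applies,
  which needs \<open>u < 1\<close>.\<close>

lemma innerFxi_eq:
  assumes "1 \<le> k" "\<And>j. j \<in> {2..k} \<Longrightarrow> 0 \<le> y j" "u = 2*\<xi>/\<theta>" "0 \<le> u" "u < 1"
  shows "innerFxi k \<theta> \<xi> s a b c y = (if tsum k y \<le> 1 - u then 1 / (1 - u) * Gsum k s a b c u y else 0)"
proof -
  let ?v = "1 - tsum k y"
  let ?q = "\<lambda>w. \<Sum>i=0..s. a i * (\<Sum>c1=0..c i. real (c i choose c1) *
         ((?v - w) ^ b i * w ^ (2 * c i - 2 * c1) * tsq k y ^ c1))"
  have S: "0 \<le> tsum k y" using assms(2) by (intro sum_nonneg) auto
  have FF: "FF k s a b c (y(1 := u + (1 - u) * t)) = (if u + (1 - u) * t \<le> ?v then ?q (u + (1 - u) * t) else 0)"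
    if "t \<in> {0..1}" for t
    using assms(1,2,4,5) that by (intro FF_upd_1) auto
  have *: "innerFxi k \<theta> \<xi> s a b c y = integral {0..1} (\<lambda>t. if u + (1 - u) * t \<le> ?v then ?q (u + (1 - u) * t) else 0)"
    unfolding innerFxi_def assms(3)[symmetric] by (intro integral_cong FF)
  show ?thesis
  proof (cases "tsum k y \<le> 1 - u")
    case True
    have "(?q has_integral Gsum k s a b c u y) {u..?v}"
      unfolding Gsum_def using assms(4,5) True
      by (intro has_integral_sum has_integral_mult_right has_integral_mult_left has_integral_tailpow) auto
    from has_integral_truncated_affine[OF this assms(5)]
    show ?thesis
      unfolding * using True S by (simp add: integral_unique)
  next
    case False
    have "u \<le> u + (1 - u) * t" if "t \<in> {0..1}" for t
      using that assms(5) by auto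
    with False have "integral {0..1} (\<lambda>t. if u + (1 - u) * t \<le> ?v then ?q (u + (1 - u) * t) else 0) = integral {0..1} (\<lambda>t::real. 0)"
      by (intro integral_cong) force
    then show ?thesis unfolding * using False by simp
  qed
qed

text \<open>Facts about \<open>F\<close> thereby become the case \<open>u = 0\<close> of facts about
  \<open>F_\<xi>\<close>.\<close>

lemma innerF_eq: "innerF k s a b c y = innerFxi k \<theta> 0 s a b c y"
  by (simp add: innerF_def innerFxi_def)

section \<open>Products of two inner integrals\<close>

lemma tailpow_0: "tailpow p a 0 v = fact p * fact a / fact (p + a + 1) * v ^ (p + a + 1)"
  by (simp add: tailpow_def)

text \<open>At lower limit \<open>0\<close> the second factor is a single power of \<open>v\<close>,
  so the two parts of the first factor yield the \<open>delta\<close> term and the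
  \<open>eps\<close> terms.\<close>

lemma tailpow_mult_tailpow_0:
  assumes "c1 \<le> c i" "c2 \<le> c j"
  shows "tailpow (b i) (2 * c i - 2 * c1) u v * tailpow (b j) (2 * c j - 2 * c2) 0 v =
     delta b c i j c1 c2 * v ^ (b i + b j + 2*c i + 2*c j - 2*c1 - 2*c2 + 2)
     - (\<Sum>b1=0..b i. (-1) ^ b1 * real (b i choose b1) * eps b c i j c1 c2 b1
          * u ^ (b1 + 2*c i - 2*c1 + 1) * v ^ (b i - b1 + b j + 2*c j - 2*c2 + 1))"
proof -
  \<comment> \<open>Removes the truncated subtractions, so that exponents and factorials
    normalise.\<close>
  obtain e e' where e: "c i = c1 + e" "c j = c2 + e'"
    using assms by (metis le_Suc_ex)
  show ?thesis
    unfolding tailpow_0 unfolding tailpow_def left_diff_distrib sum_distrib_right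
  proof (intro arg_cong2[where f = "(-)"] sum.cong refl)
    fix q assume "q \<in> {0..b i}"
    then obtain x where "b i = q + x" by (metis atLeastAtMost_iff le_Suc_ex)
    then show "(-1) ^ q * real (b i choose q) * v ^ (b i - q) *
         (u ^ (q + (2 * c i - 2 * c1) + 1) / real (q + (2 * c i - 2 * c1) + 1)) *
         (fact (b j) * fact (2 * c j - 2 * c2) / fact (b j + (2 * c j - 2 * c2) + 1) *
           v ^ (b j + (2 * c j - 2 * c2) + 1)) =
       (-1) ^ q * real (b i choose q) * eps b c i j c1 c2 q
          * u ^ (q + 2*c i - 2*c1 + 1) * v ^ (b i - q + b j + 2*c j - 2*c2 + 1)"
      by (simp add: eps_def e power_add power2_eq_square mult_ac)
  qed (simp add: delta_def e power_add power2_eq_square mult_ac)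
qed

lemma tailpow_mult_tailpow:
  assumes "c1 \<le> c i" "c2 \<le> c j"
  shows "tailpow (b i) (2 * c i - 2 * c1) u v * tailpow (b j) (2 * c j - 2 * c2) u v =
     delta b c i j c1 c2 * v ^ (b i + b j + 2*c i + 2*c j - 2*c1 - 2*c2 + 2)
     - (\<Sum>b1=0..b i. (-1) ^ b1 * real (b i choose b1) * eps b c i j c1 c2 b1
          * u ^ (b1 + 2*c i - 2*c1 + 1) * v ^ (b i - b1 + b j + 2*c j - 2*c2 + 1))
     - (\<Sum>b1=0..b j. (-1) ^ b1 * real (b j choose b1) * eps b c j i c2 c1 b1
          * u ^ (b1 + 2*c j - 2*c2 + 1) * v ^ (b j - b1 + b i + 2*c i - 2*c1 + 1))
     + (\<Sum>b1=0..b i. \<Sum>b2=0..b j. (-1) ^ (b1 + b2) * real (b i choose b1) * real (b j choose b2)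
          * u ^ (2*c i + 2*c j - 2*c1 - 2*c2 + b1 + b2 + 2) / zeta b c i j c1 c2 b1 b2
          * v ^ (b i + b j - b1 - b2))"
proof -
  obtain e e' where e: "c i = c1 + e" "c j = c2 + e'"
    using assms by (metis le_Suc_ex)
  let ?t = "\<lambda>i e u. tailpow (b i) e u v"
  let ?h = "\<lambda>i e. (\<Sum>q=0..b i. (-1) ^ q * real (b i choose q) * v ^ (b i - q) * (u ^ (q + e + 1) / real (q + e + 1)))"
  let ?ei = "2 * c i - 2 * c1" and ?ej = "2 * c j - 2 * c2"
  have t: "?t i e u = ?t i e 0 - ?h i e" for i e
    unfolding tailpow_0 by (simp add: tailpow_def)
  \<comment> \<open>Both products with one lower limit \<open>0\<close> are instances of the
    previous lemma, the second with the roles of \<open>i\<close> and \<open>j\<close> exchanged;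
    their common leading term is counted twice and subtracted once.\<close>
  have prod: "?t i ?ei u * ?t j ?ej u = ?t i ?ei u * ?t j ?ej 0 + ?t j ?ej u * ?t i ?ei 0
      - ?t i ?ei 0 * ?t j ?ej 0 + ?h i ?ei * ?h j ?ej"
    unfolding t[of i ?ei] t[of j ?ej] by (simp add: algebra_simps)
  have hh: "?h i ?ei * ?h j ?ej = (\<Sum>b1=0..b i. \<Sum>b2=0..b j. (-1) ^ (b1 + b2) * real (b i choose b1) * real (b j choose b2)
          * u ^ (2*c i + 2*c j - 2*c1 - 2*c2 + b1 + b2 + 2) / zeta b c i j c1 c2 b1 b2
          * v ^ (b i + b j - b1 - b2))"
    unfolding sum_product
  proof (intro sum.cong refl)
    fix b1 b2 assume "b1 \<in> {0..b i}" "b2 \<in> {0..b j}"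
    then obtain x y where xy: "b i = b1 + x" "b j = b2 + y" by (metis atLeastAtMost_iff le_Suc_ex)
    show "(-1) ^ b1 * real (b i choose b1) * v ^ (b i - b1) * (u ^ (b1 + ?ei + 1) / real (b1 + ?ei + 1)) *
       ((-1) ^ b2 * real (b j choose b2) * v ^ (b j - b2) * (u ^ (b2 + ?ej + 1) / real (b2 + ?ej + 1))) =
       (-1) ^ (b1 + b2) * real (b i choose b1) * real (b j choose b2)
          * u ^ (2*c i + 2*c j - 2*c1 - 2*c2 + b1 + b2 + 2) / zeta b c i j c1 c2 b1 b2
          * v ^ (b i + b j - b1 - b2)"
      by (simp add: zeta_def e xy power_add power2_eq_square mult_ac)
  qed
  have i0: "?t i ?ei 0 * ?t j ?ej 0 = delta b c i j c1 c2 * v ^ (b i + b j + 2*c i + 2*c j - 2*c1 - 2*c2 + 2)"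
    using tailpow_mult_tailpow_0[where b=b and c=c and i=i and j=j and u=0, OF assms] by simp
  have sym: "delta b c j i c2 c1 * v ^ (b j + b i + 2*c j + 2*c i - 2*c2 - 2*c1 + 2)
       = delta b c i j c1 c2 * v ^ (b i + b j + 2*c i + 2*c j - 2*c1 - 2*c2 + 2)"
    by (simp add: delta_def e mult_ac add_ac)
  show ?thesis
    unfolding prod hh i0
      tailpow_mult_tailpow_0[where b=b and c=c and i=i and j=j and u=u, OF assms]
      tailpow_mult_tailpow_0[where b=b and c=c and i=j and j=i and u=u, OF assms(2,1)] sym by simp
qed

section \<open>Integration over the outer variables\<close>

text \<open>For \<open>k \<ge> 2\<close>, \<open>r \<ge> 0\<close> and
  \<open>M = k - 1 + 2*c1 + 2*c2\<close>, this is \<open>1/(M - 1)!\<close> times the integral of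
  \<open>(1 - s)^p s^(M - 1)\<close> over \<open>{0..r}\<close>, with the indices spelled as in the
  right-hand sides.\<close>

definition tail_moment :: "nat \<Rightarrow> nat \<Rightarrow> nat \<Rightarrow> nat \<Rightarrow> real \<Rightarrow> real" where
  "tail_moment k c1 c2 p r = (\<Sum>d=0..p. (-1::real)^d * real (p choose d) * r ^ (k - 1 + d + 2*c1 + 2*c2)
     / (fact (k + 2*c1 + 2*c2 - 2) * real (k - 1 + 2*c1 + 2*c2 + d)))"

lemma has_iint_tail_moment:
  assumes "2 \<le> k" "0 \<le> r" "r \<le> 1"
  shows "has_iint [2..<k+1] (\<lambda>y. if tsum k y \<le> r then (1 - tsum k y) ^ p * tsq k y ^ (c1 + c2) else 0) y
     (Qc (c1 + c2) (real (k - 1)) * tail_moment k c1 c2 p r)"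
proof -
  have set: "set [2..<k+1] = {2..k}" by auto
  have len: "length [2..<k+1] = k - 1" by auto
  have "k - 1 + 2 * (c1 + c2) - 1 = k + 2*c1 + 2*c2 - 2"
    "k - 1 + 2 * (c1 + c2) + d = k - 1 + d + 2*c1 + 2*c2" for d
    using assms by auto
  then have "Qc (c1 + c2) (real (k - 1)) / fact (k - 1 + 2 * (c1 + c2) - 1) *
             (\<Sum>d=0..p. (-1) ^ d * real (p choose d) * r ^ (k - 1 + 2 * (c1 + c2) + d) / real (k - 1 + 2 * (c1 + c2) + d))
      = Qc (c1 + c2) (real (k - 1)) * tail_moment k c1 c2 p r"
    by (simp add: tail_moment_def sum_distrib_left sum_divide_distrib mult_ac add_ac)
  with has_iint_truncated_moment[of "[2..<k+1]" r p "c1 + c2" y] assms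
  show ?thesis
    unfolding set len by simp
qed

text \<open>At powers of \<open>r\<close> the innermost alternating sum becomes a
  \<open>tail_moment\<close>, the quantity produced by the outer integration; likewise for
  \<open>Egen\<close> and \<open>Fgen\<close>.\<close>

lemma Dgen_power:
  "Dgen k b c i j c1 c2 (\<lambda>m. r ^ m) =
     delta b c i j c1 c2 * tail_moment k c1 c2 (b i + b j + 2*c i + 2*c j - 2*c1 - 2*c2 + 2) r"
  unfolding Dgen_def tail_moment_def Let_def sum_distrib_left
  by (intro sum.cong refl) (simp add: mult_ac)

lemma Egen_power:
  "Egen k b c i j c1 c2 (\<lambda>m n. u ^ m * r ^ n) =
     (\<Sum>b1=0..b i. (-1) ^ b1 * real (b i choose b1) * eps b c i j c1 c2 b1 * u ^ (b1 + 2*c i - 2*c1 + 1)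
         * tail_moment k c1 c2 (b i - b1 + b j + 2*c j - 2*c2 + 1) r)"
  unfolding Egen_def tail_moment_def Let_def sum_distrib_left
  by (intro sum.cong refl) (simp add: power_add[of "-1"] mult_ac)

lemma Fgen_power:
  "Fgen k b c i j c1 c2 (\<lambda>m n. u ^ m * r ^ n) =
     (\<Sum>b1=0..b i. \<Sum>b2=0..b j. (-1) ^ (b1 + b2) * real (b i choose b1) * real (b j choose b2)
          * u ^ (2*c i + 2*c j - 2*c1 - 2*c2 + b1 + b2 + 2) / zeta b c i j c1 c2 b1 b2
         * tail_moment k c1 c2 (b i + b j - b1 - b2) r)"
  unfolding Fgen_def tail_moment_def Let_def sum_distrib_left
  by (intro sum.cong refl) (simp add: power_add[of "-1"] mult_ac)

lemma has_iint_tailpow_mult_tailpow_0: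
  assumes "2 \<le> k" "0 \<le> u" "u \<le> 1" "c1 \<le> c i" "c2 \<le> c j"
  shows "has_iint [2..<k+1] (\<lambda>y. if tsum k y \<le> 1 - u then
        tailpow (b i) (2 * c i - 2 * c1) u (1 - tsum k y) * tailpow (b j) (2 * c j - 2 * c2) 0 (1 - tsum k y)
        * tsq k y ^ (c1 + c2) else 0) y
     (Qc (c1 + c2) (real (k - 1)) *
       (Dgen k b c i j c1 c2 (\<lambda>m. (1 - u) ^ m) - Egen k b c i j c1 c2 (\<lambda>m n. u ^ m * (1 - u) ^ n)))"
proof -
  let ?Q = "Qc (c1 + c2) (real (k - 1))"
  let ?dt = "b i + b j + 2*c i + 2*c j - 2*c1 - 2*c2 + 2"
  let ?et = "\<lambda>b1. b i - b1 + b j + 2*c j - 2*c2 + 1"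
  let ?ec = "\<lambda>b1. (-1) ^ b1 * real (b i choose b1) * eps b c i j c1 c2 b1 * u ^ (b1 + 2*c i - 2*c1 + 1)"
  let ?m = "\<lambda>p y. if tsum k y \<le> 1 - u then (1 - tsum k y) ^ p * tsq k y ^ (c1 + c2) else 0"
  have "has_iint [2..<k+1] (\<lambda>y. delta b c i j c1 c2 * ?m ?dt y - (\<Sum>b1=0..b i. ?ec b1 * ?m (?et b1) y)) y
     (delta b c i j c1 c2 * (?Q * tail_moment k c1 c2 ?dt (1 - u))
       - (\<Sum>b1=0..b i. ?ec b1 * (?Q * tail_moment k c1 c2 (?et b1) (1 - u))))"
    using assms by (intro has_iint_diff has_iint_sum has_iint_cmult has_iint_tail_moment) auto
  also have "(delta b c i j c1 c2 * (?Q * tail_moment k c1 c2 ?dt (1 - u))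
       - (\<Sum>b1=0..b i. ?ec b1 * (?Q * tail_moment k c1 c2 (?et b1) (1 - u)))) =
     ?Q * (Dgen k b c i j c1 c2 (\<lambda>m. (1 - u) ^ m) - Egen k b c i j c1 c2 (\<lambda>m n. u ^ m * (1 - u) ^ n))"
    unfolding Dgen_power Egen_power right_diff_distrib sum_distrib_left
    by (intro arg_cong2[where f = "(-)"] sum.cong refl) (simp_all only: mult_ac)
  finally show ?thesis
  proof (rule has_iint_cong)
    fix y
    show "delta b c i j c1 c2 * ?m ?dt y - (\<Sum>b1=0..b i. ?ec b1 * ?m (?et b1) y) =
      (if tsum k y \<le> 1 - u then
        tailpow (b i) (2 * c i - 2 * c1) u (1 - tsum k y) * tailpow (b j) (2 * c j - 2 * c2) 0 (1 - tsum k y)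
        * tsq k y ^ (c1 + c2) else 0)"
      unfolding tailpow_mult_tailpow_0[where b=b and c=c and i=i and j=j and u=u, OF assms(4,5)]
      by (simp only: left_diff_distrib sum_distrib_right mult.assoc split: if_split) simp
  qed
qed

lemma has_iint_tailpow_mult_tailpow:
  assumes "2 \<le> k" "0 \<le> u" "u \<le> 1" "c1 \<le> c i" "c2 \<le> c j"
  shows "has_iint [2..<k+1] (\<lambda>y. if tsum k y \<le> 1 - u then
        tailpow (b i) (2 * c i - 2 * c1) u (1 - tsum k y) * tailpow (b j) (2 * c j - 2 * c2) u (1 - tsum k y)
        * tsq k y ^ (c1 + c2) else 0) y
     (Qc (c1 + c2) (real (k - 1)) *
       (Dgen k b c i j c1 c2 (\<lambda>m. (1 - u) ^ m) - Egen k b c i j c1 c2 (\<lambda>m n. u ^ m * (1 - u) ^ n)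
        - Egen k b c j i c2 c1 (\<lambda>m n. u ^ m * (1 - u) ^ n) + Fgen k b c i j c1 c2 (\<lambda>m n. u ^ m * (1 - u) ^ n)))"
proof -
  let ?Q = "Qc (c1 + c2) (real (k - 1))"
  let ?dt = "b i + b j + 2*c i + 2*c j - 2*c1 - 2*c2 + 2"
  let ?et = "\<lambda>i j c1 c2 b1. b i - b1 + b j + 2*c j - 2*c2 + 1"
  let ?ec = "\<lambda>i j c1 c2 b1. (-1) ^ b1 * real (b i choose b1) * eps b c i j c1 c2 b1 * u ^ (b1 + 2*c i - 2*c1 + 1)"
  let ?fc = "\<lambda>b1 b2. (-1) ^ (b1 + b2) * real (b i choose b1) * real (b j choose b2)
          * u ^ (2*c i + 2*c j - 2*c1 - 2*c2 + b1 + b2 + 2) / zeta b c i j c1 c2 b1 b2"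
  let ?m = "\<lambda>p y. if tsum k y \<le> 1 - u then (1 - tsum k y) ^ p * tsq k y ^ (c1 + c2) else 0"
  let ?V = "\<lambda>p. tail_moment k c1 c2 p (1 - u)"
  have comm: "tail_moment k c2 c1 p r = tail_moment k c1 c2 p r" for p r
    by (simp add: tail_moment_def add_ac)
  have "has_iint [2..<k+1] (\<lambda>y. delta b c i j c1 c2 * ?m ?dt y
        - (\<Sum>b1=0..b i. ?ec i j c1 c2 b1 * ?m (?et i j c1 c2 b1) y)
        - (\<Sum>b1=0..b j. ?ec j i c2 c1 b1 * ?m (?et j i c2 c1 b1) y)
        + (\<Sum>b1=0..b i. \<Sum>b2=0..b j. ?fc b1 b2 * ?m (b i + b j - b1 - b2) y)) y
     (delta b c i j c1 c2 * (?Q * ?V ?dt)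
       - (\<Sum>b1=0..b i. ?ec i j c1 c2 b1 * (?Q * ?V (?et i j c1 c2 b1)))
       - (\<Sum>b1=0..b j. ?ec j i c2 c1 b1 * (?Q * ?V (?et j i c2 c1 b1)))
       + (\<Sum>b1=0..b i. \<Sum>b2=0..b j. ?fc b1 b2 * (?Q * ?V (b i + b j - b1 - b2))))"
    using assms by (intro has_iint_add has_iint_diff has_iint_sum has_iint_cmult has_iint_tail_moment) auto
  also have "(delta b c i j c1 c2 * (?Q * ?V ?dt)
       - (\<Sum>b1=0..b i. ?ec i j c1 c2 b1 * (?Q * ?V (?et i j c1 c2 b1)))
       - (\<Sum>b1=0..b j. ?ec j i c2 c1 b1 * (?Q * ?V (?et j i c2 c1 b1)))
       + (\<Sum>b1=0..b i. \<Sum>b2=0..b j. ?fc b1 b2 * (?Q * ?V (b i + b j - b1 - b2)))) =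
     ?Q * (Dgen k b c i j c1 c2 (\<lambda>m. (1 - u) ^ m) - Egen k b c i j c1 c2 (\<lambda>m n. u ^ m * (1 - u) ^ n)
        - Egen k b c j i c2 c1 (\<lambda>m n. u ^ m * (1 - u) ^ n) + Fgen k b c i j c1 c2 (\<lambda>m n. u ^ m * (1 - u) ^ n))"
    unfolding Dgen_power Egen_power Fgen_power right_diff_distrib distrib_left sum_distrib_left comm
    by (intro arg_cong2[where f = "(-)"] arg_cong2[where f = "(+)"] sum.cong refl) (simp_all only: mult_ac)
  finally show ?thesis
  proof (rule has_iint_cong)
    fix y
    show "delta b c i j c1 c2 * ?m ?dt y
        - (\<Sum>b1=0..b i. ?ec i j c1 c2 b1 * ?m (?et i j c1 c2 b1) y)
        - (\<Sum>b1=0..b j. ?ec j i c2 c1 b1 * ?m (?et j i c2 c1 b1) y)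
        + (\<Sum>b1=0..b i. \<Sum>b2=0..b j. ?fc b1 b2 * ?m (b i + b j - b1 - b2) y) =
      (if tsum k y \<le> 1 - u then
        tailpow (b i) (2 * c i - 2 * c1) u (1 - tsum k y) * tailpow (b j) (2 * c j - 2 * c2) u (1 - tsum k y)
        * tsq k y ^ (c1 + c2) else 0)"
      unfolding tailpow_mult_tailpow[where b=b and c=c and i=i and j=j and u=u, OF assms(4,5)]
      by (simp only: left_diff_distrib distrib_right sum_distrib_right mult.assoc split: if_split) simp
  qed
qed

lemma Gsum_mult_Gsum:
  "Gsum k s a b c u y * Gsum k s a b c u' y = (\<Sum>i=0..s. \<Sum>j=0..s. a i * a j *
      (\<Sum>c1=0..c i. \<Sum>c2=0..c j. real (c i choose c1) * real (c j choose c2) *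
         (tailpow (b i) (2 * c i - 2 * c1) u (1 - tsum k y) * tailpow (b j) (2 * c j - 2 * c2) u' (1 - tsum k y)
          * tsq k y ^ (c1 + c2))))"
proof -
  have *: "(a i * (\<Sum>c1=0..c i. X c1)) * (a j * (\<Sum>c2=0..c j. Y c2))
      = a i * a j * (\<Sum>c1=0..c i. \<Sum>c2=0..c j. X c1 * Y c2)" for i j and X Y :: "nat \<Rightarrow> real"
    by (simp add: sum_product mult_ac)
  show ?thesis
    unfolding Gsum_def sum_product[of _ "{0..s}"] *
    by (intro sum.cong refl) (simp only: power_add mult_ac)
qed

text \<open>The two lower limits are kept apart to cover both \<open>L\<close>
  (\<open>u' = 0\<close>) and \<open>M\<close> (\<open>u' = u\<close>).\<close>

lemma has_iint_Gsum_mult_Gsum: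
  assumes "\<And>i j c1 c2. c1 \<le> c i \<Longrightarrow> c2 \<le> c j \<Longrightarrow>
      has_iint [2..<k+1] (\<lambda>y. if tsum k y \<le> r then
        tailpow (b i) (2 * c i - 2 * c1) u (1 - tsum k y) * tailpow (b j) (2 * c j - 2 * c2) u' (1 - tsum k y)
        * tsq k y ^ (c1 + c2) else 0) y (Qc (c1 + c2) (real (k - 1)) * X i j c1 c2)"
  shows "has_iint [2..<k+1] (\<lambda>y. if tsum k y \<le> r then Gsum k s a b c u y * Gsum k s a b c u' y else 0) y
           (quadsum k s a c X)"
proof -
  have "has_iint [2..<k+1] (\<lambda>y. \<Sum>i=0..s. \<Sum>j=0..s. a i * a j *
      (\<Sum>c1=0..c i. \<Sum>c2=0..c j. real (c i choose c1) * real (c j choose c2) *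
        (if tsum k y \<le> r then
        tailpow (b i) (2 * c i - 2 * c1) u (1 - tsum k y) * tailpow (b j) (2 * c j - 2 * c2) u' (1 - tsum k y)
        * tsq k y ^ (c1 + c2) else 0))) y
     (\<Sum>i=0..s. \<Sum>j=0..s. a i * a j *
        (\<Sum>c1=0..c i. \<Sum>c2=0..c j. real (c i choose c1) * real (c j choose c2)
            * (Qc (c1 + c2) (real (k - 1)) * X i j c1 c2)))"
    by (intro has_iint_sum has_iint_cmult assms) auto
  then have "has_iint [2..<k+1] (\<lambda>y. \<Sum>i=0..s. \<Sum>j=0..s. a i * a j *
      (\<Sum>c1=0..c i. \<Sum>c2=0..c j. real (c i choose c1) * real (c j choose c2) *
        (if tsum k y \<le> r then
        tailpow (b i) (2 * c i - 2 * c1) u (1 - tsum k y) * tailpow (b j) (2 * c j - 2 * c2) u' (1 - tsum k y)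
        * tsq k y ^ (c1 + c2) else 0))) y (quadsum k s a c X)"
    by (simp only: quadsum_def mult.assoc)
  then show ?thesis
    by (rule has_iint_cong) (simp only: Gsum_mult_Gsum split: if_split, simp)
qed

lemma quadsum_swap: "quadsum k s a c (\<lambda>i j c1 c2. X j i c2 c1) = quadsum k s a c X"
  unfolding quadsum_def
  by (subst sum.swap, intro sum.cong refl, subst (2) sum.swap)
     (simp only: mult_ac add.commute)

lemma quadsum_add:
  "quadsum k s a c (\<lambda>i j c1 c2. X i j c1 c2 + Y i j c1 c2) = quadsum k s a c X + quadsum k s a c Y"
  by (simp add: quadsum_def sum.distrib distrib_left)

lemma quadsum_cmult:
  "quadsum k s a c (\<lambda>i j c1 c2. \<kappa> * X i j c1 c2) = \<kappa> * quadsum k s a c X"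
  unfolding quadsum_def sum_distrib_left by (intro sum.cong refl) (simp only: mult_ac)

text \<open>The two cross terms differ by exchanging \<open>(i, c1)\<close> with
  \<open>(j, c2)\<close>, which leaves the full sum invariant; hence the coefficient
  \<open>2\<close>.\<close>

lemma Mgen_eq:
  "quadsum k s a c (\<lambda>i j c1 c2. Dgen k b c i j c1 c2 \<phi> - Egen k b c i j c1 c2 \<psi>
      - Egen k b c j i c2 c1 \<psi> + Fgen k b c i j c1 c2 \<psi>) = Mgen k s a b c \<phi> \<psi>"
proof -
  let ?q = "quadsum k s a c"
  let ?D = "\<lambda>i j c1 c2. Dgen k b c i j c1 c2 \<phi>" and ?F = "\<lambda>i j c1 c2. Fgen k b c i j c1 c2 \<psi>"
  let ?E = "\<lambda>i j c1 c2. Egen k b c i j c1 c2 \<psi>"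
  have "?q (\<lambda>i j c1 c2. ?D i j c1 c2 - ?E i j c1 c2 - ?E j i c2 c1 + ?F i j c1 c2)
      = ?q (\<lambda>i j c1 c2. ?D i j c1 c2 + (- 1) * ?E i j c1 c2 + (- 1) * ?E j i c2 c1 + ?F i j c1 c2)"
    by simp
  also have "\<dots> = ?q ?D + (-1) * ?q ?E + (-1) * ?q ?E + ?q ?F"
    unfolding quadsum_add quadsum_cmult quadsum_swap[of k s a c ?E] ..
  also have "\<dots> = ?q ?D + (-2) * ?q ?E + ?q ?F" by simp
  also have "\<dots> = ?q (\<lambda>i j c1 c2. ?D i j c1 c2 + (-2) * ?E i j c1 c2 + ?F i j c1 c2)"
    unfolding quadsum_add quadsum_cmult ..
  also have "\<dots> = Mgen k s a b c \<phi> \<psi>"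
    unfolding Mgen_def by simp
  finally show ?thesis .
qed

section \<open>Closed forms of the integrands of \<open>L\<close> and \<open>M\<close>, and of
  \<open>J\<close>\<close>

lemma cube_int_eqI:
  assumes "has_iint [2..<k+1] f (\<lambda>_. 0) v"
    and "\<And>y :: nat \<Rightarrow> real. (\<And>j. j \<in> {2..k} \<Longrightarrow> 0 \<le> y j) \<Longrightarrow> f y = g y"
  shows "cube_int k g = v"
  unfolding cube_int_def
proof (rule has_iint_imp_iint, rule has_iint_cong[OF assms(1)])
  fix y :: "nat \<Rightarrow> real" assume y: "\<And>j. j \<in> set [2..<k+1] \<Longrightarrow> 0 \<le> y j \<and> y j \<le> 1"
  show "f y = g y"
  proof (rule assms(2))
    fix j assume "j \<in> {2..k}"
    then have "j \<in> set [2..<k+1]" by auto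
    with y show "0 \<le> y j" by blast
  qed
qed

lemma cube_int_innerFxi_mult_innerF:
  assumes "2 \<le> k" "u = 2*\<xi>/\<theta>" "0 \<le> u" "u < 1"
  shows "cube_int k (\<lambda>y. innerFxi k \<theta> \<xi> s a b c y * innerF k s a b c y) =
     1 / (1 - u) * Lgen k s a b c (\<lambda>m. (1 - u) ^ m) (\<lambda>m n. u ^ m * (1 - u) ^ n)"
proof (rule cube_int_eqI)
  show "has_iint [2..<k+1] (\<lambda>y. 1 / (1 - u) * (if tsum k y \<le> 1 - u then Gsum k s a b c u y * Gsum k s a b c 0 y else 0)) (\<lambda>_. 0)
     (1 / (1 - u) * Lgen k s a b c (\<lambda>m. (1 - u) ^ m) (\<lambda>m n. u ^ m * (1 - u) ^ n))"
    unfolding Lgen_def using assms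
    by (intro has_iint_cmult has_iint_Gsum_mult_Gsum has_iint_tailpow_mult_tailpow_0) auto
next
  fix y :: "nat \<Rightarrow> real" assume y: "\<And>j. j \<in> {2..k} \<Longrightarrow> 0 \<le> y j"
  have "innerFxi k \<theta> \<xi> s a b c y = (if tsum k y \<le> 1 - u then 1 / (1 - u) * Gsum k s a b c u y else 0)"
    using assms y by (intro innerFxi_eq) auto
  moreover have "innerF k s a b c y = (if tsum k y \<le> 1 - 0 then 1 / (1 - 0) * Gsum k s a b c 0 y else 0)"
    unfolding innerF_eq[where \<theta> = \<theta>] using assms y by (intro innerFxi_eq) auto
  \<comment> \<open>The support condition \<open>tsum k y \<le> 1 - u\<close> of the first factor
    implies the condition \<open>tsum k y \<le> 1\<close> of the second.\<close>
  ultimately show "1 / (1 - u) * (if tsum k y \<le> 1 - u then Gsum k s a b c u y * Gsum k s a b c 0 y else 0)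
     = innerFxi k \<theta> \<xi> s a b c y * innerF k s a b c y"
    using assms(3) by (simp only: split: if_split) simp
qed

lemma cube_int_innerFxi_power2:
  assumes "2 \<le> k" "u = 2*\<xi>/\<theta>" "0 \<le> u" "u < 1"
  shows "cube_int k (\<lambda>y. (innerFxi k \<theta> \<xi> s a b c y)\<^sup>2) =
     (1 / (1 - u))\<^sup>2 * Mgen k s a b c (\<lambda>m. (1 - u) ^ m) (\<lambda>m n. u ^ m * (1 - u) ^ n)"
proof (rule cube_int_eqI)
  show "has_iint [2..<k+1] (\<lambda>y. (1 / (1 - u))\<^sup>2 * (if tsum k y \<le> 1 - u then Gsum k s a b c u y * Gsum k s a b c u y else 0)) (\<lambda>_. 0)
     ((1 / (1 - u))\<^sup>2 * Mgen k s a b c (\<lambda>m. (1 - u) ^ m) (\<lambda>m n. u ^ m * (1 - u) ^ n))"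
    unfolding Mgen_eq[symmetric] using assms
    by (intro has_iint_cmult has_iint_Gsum_mult_Gsum has_iint_tailpow_mult_tailpow) auto
next
  fix y :: "nat \<Rightarrow> real" assume y: "\<And>j. j \<in> {2..k} \<Longrightarrow> 0 \<le> y j"
  have "innerFxi k \<theta> \<xi> s a b c y = (if tsum k y \<le> 1 - u then 1 / (1 - u) * Gsum k s a b c u y else 0)"
    using assms y by (intro innerFxi_eq) auto
  then show "(1 / (1 - u))\<^sup>2 * (if tsum k y \<le> 1 - u then Gsum k s a b c u y * Gsum k s a b c u y else 0)
     = (innerFxi k \<theta> \<xi> s a b c y)\<^sup>2"
    by (simp add: power2_eq_square)
qed

text \<open>Both closed forms at \<open>\<xi> = 0\<close>, with \<open>\<theta> = 1\<close> chosen
  arbitrarily. The powers of \<open>1 - 0\<close> and \<open>0\<close> stay unsimplified to match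
  \<open>lincomb_limit\<close>.\<close>

lemma Jk_eq:
  assumes "2 \<le> k"
  shows "Jk k s a b c = Lgen k s a b c (\<lambda>m. (1 - 0) ^ m) (\<lambda>m n. 0 ^ m * (1 - 0) ^ n)"
    and "Jk k s a b c = Mgen k s a b c (\<lambda>m. (1 - 0) ^ m) (\<lambda>m n. 0 ^ m * (1 - 0) ^ n)"
  using cube_int_innerFxi_mult_innerF[OF assms, where u = 0 and \<xi> = 0 and \<theta> = 1 and s=s and a=a and b=b and c=c]
    cube_int_innerFxi_power2[OF assms, where u = 0 and \<xi> = 0 and \<theta> = 1 and s=s and a=a and b=b and c=c]
  unfolding innerF_eq[where \<theta> = 1, symmetric] by (simp_all add: Jk_def power2_eq_square)

section \<open>The integrals over \<open>\<xi>\<close> and the limit\<close>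

lemma pochhammer_Suc_of_nat: "pochhammer (real (Suc q)) j = fact (q + j) / fact q"
proof (induction j)
  case (Suc j)
  show ?case
    unfolding pochhammer_Suc Suc.IH by (simp add: algebra_simps add_divide_distrib)
qed simp

text \<open>The integrand is \<open>(\<theta>/2) / (\<xi> (1 - \<xi>))\<close> times
  \<open>u^m (1 - u)^n\<close> with \<open>u = 2\<xi>/\<theta>\<close>, one factor \<open>u\<close>
  being absorbed by the weight. Expanding \<open>1/(1 - \<xi>)\<close> geometrically gives Beta
  integrals proportional to the terms of the hypergeometric series.\<close>

lemma has_integral_mu:
  assumes "0 < \<theta>" "\<theta> < 2" "0 < m"
  shows "((\<lambda>\<xi>. (2*\<xi>/\<theta>) ^ (m - 1) * (1 - 2*\<xi>/\<theta>) ^ n / (1 - \<xi>)) has_integral mu \<theta> m n) {0..\<theta>/2}"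
proof -
  obtain q where q: "m = Suc q" using assms by (cases m) auto
  define T where "T = \<theta> / 2"
  have T: "0 < T" "T < 1" using assms by (auto simp: T_def)
  have u: "2 * \<xi> / \<theta> = \<xi> / T" for \<xi> by (simp add: T_def)
  let ?p = "\<lambda>\<xi>. (\<xi> / T) ^ q * (1 - \<xi> / T) ^ n"
  let ?f = "\<lambda>\<xi>. ?p \<xi> / (1 - \<xi>)"
  define A where "A j = T ^ Suc j * (fact n * fact (q + j) / fact (n + q + j + 1))" for j
  have Aint: "((\<lambda>\<xi>. \<xi> ^ j * ?p \<xi>) has_integral A j) {0..T}" for j
  proof -
    have "((\<lambda>\<xi>. 1 / T ^ (q + n) * ((T - \<xi>) ^ n * \<xi> ^ (q + j))) has_integral
       1 / T ^ (q + n) * (fact n * fact (q + j) / fact (n + (q + j) + 1) * T ^ (n + (q + j) + 1))) {0..T}"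
      using T by (intro has_integral_mult_right has_integral_power_mult_power) auto
    also have "(\<lambda>\<xi>. 1 / T ^ (q + n) * ((T - \<xi>) ^ n * \<xi> ^ (q + j))) = (\<lambda>\<xi>. \<xi> ^ j * ?p \<xi>)"
    proof
      fix \<xi>
      have "1 - \<xi> / T = (T - \<xi>) / T" using T by (simp add: field_simps)
      then show "1 / T ^ (q + n) * ((T - \<xi>) ^ n * \<xi> ^ (q + j)) = \<xi> ^ j * ?p \<xi>"
        using T by (simp add: power_divide power_add)
    qed
    also have "1 / T ^ (q + n) * (fact n * fact (q + j) / fact (n + (q + j) + 1) * T ^ (n + (q + j) + 1)) = A j"
      using T unfolding A_def by (simp add: power_add add.assoc)
    finally show ?thesis .
  qed
  have fint: "?f integrable_on {0..T}"
    using T by (intro integrable_continuous_interval continuous_intros) auto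
  have sums: "A sums integral {0..T} ?f"
    unfolding sums_def
  proof (rule Lim_transform)
    show "(\<lambda>N. integral {0..T} ?f) \<longlonglongrightarrow> integral {0..T} ?f" by simp
    \<comment> \<open>The error of the partial sum of \<open>1/(1 - \<xi>)\<close> is
      \<open>\<xi>^N / (1 - \<xi>)\<close>, at most \<open>T^N / (1 - T)\<close>, and the polynomial
      factor is at most \<open>1\<close>.\<close>
    have bound: "norm ((\<Sum>j<N. A j) - integral {0..T} ?f) \<le> T ^ N / (1 - T) * T" for N
    proof -
      have "((\<lambda>\<xi>. (\<Sum>j<N. \<xi> ^ j * ?p \<xi>) - ?f \<xi>) has_integral (\<Sum>j<N. A j) - integral {0..T} ?f) {0..T}"
        using fint by (intro has_integral_diff has_integral_sum Aint integrable_integral) auto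
      moreover have "norm ((\<Sum>j<N. \<xi> ^ j * ?p \<xi>) - ?f \<xi>) \<le> T ^ N / (1 - T)"
        if "\<xi> \<in> cbox 0 T" for \<xi>
      proof -
        have x: "0 \<le> \<xi>" "\<xi> \<le> T" using that by auto
        have "(1 - \<xi>) * (\<Sum>j<N. \<xi> ^ j) = 1 - \<xi> ^ N"
          by (rule one_diff_power_eq[symmetric])
        then have s: "(\<Sum>j<N. \<xi> ^ j) = (1 - \<xi> ^ N) / (1 - \<xi>)"
          using x T by (simp add: field_simps)
        have split: "(1 - \<xi> ^ N) / (1 - \<xi>) * P - P / (1 - \<xi>) = - (\<xi> ^ N * P / (1 - \<xi>))" for P
          by (simp add: diff_divide_distrib left_diff_distrib)
        have "(\<Sum>j<N. \<xi> ^ j * ?p \<xi>) - ?f \<xi> = - (\<xi> ^ N * ?p \<xi> / (1 - \<xi>))"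
          unfolding sum_distrib_right[symmetric] s by (rule split)
        also have "norm \<dots> = \<xi> ^ N * ?p \<xi> / (1 - \<xi>)"
          using x T by (simp add: abs_mult)
        also have "\<dots> \<le> T ^ N * 1 / (1 - T)"
          using x T by (intro frac_le mult_mono mult_le_one power_mono power_le_one zero_le_power mult_nonneg_nonneg) auto
        finally show ?thesis by simp
      qed
      ultimately have "norm ((\<Sum>j<N. A j) - integral {0..T} ?f) \<le> T ^ N / (1 - T) * measure lborel (cbox 0 T)"
        using T by (intro has_integral_bound[where f = "\<lambda>\<xi>. (\<Sum>j<N. \<xi> ^ j * ?p \<xi>) - ?f \<xi>"]) auto
      then show ?thesis using T by simp
    qed
    have "(\<lambda>N. T ^ N / (1 - T) * T) \<longlonglongrightarrow> 0 / (1 - T) * T"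
      using T by (intro tendsto_intros LIMSEQ_power_zero) auto
    then have lim: "(\<lambda>N. T ^ N / (1 - T) * T) \<longlonglongrightarrow> 0" by simp
    show "(\<lambda>N. (\<Sum>j<N. A j) - integral {0..T} ?f) \<longlonglongrightarrow> 0"
      by (rule Lim_null_comparison[OF _ lim]) (rule always_eventually, rule allI, rule bound)
  qed
  \<comment> \<open>The factor in front of the hypergeometric series in \<open>mu\<close>; it equals
    \<open>A 0\<close>.\<close>
  define C where "C = T / (real m * real ((m + n) choose n))"
  have C: "C = T * (fact n * fact q / fact (n + q + 1))"
  proof -
    have "real ((m + n) choose n) = fact (n + q + 1) / (fact n * (real m * fact q))"
      by (simp add: q binomial_fact add_ac)
    then show ?thesis using q by (simp add: C_def)
  qed
  let ?t = "\<lambda>j. pochhammer 1 j * pochhammer (real m) j / (pochhammer (real m + real n + 1) j * fact j) * T ^ j"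
  have "A j = C * ?t j" for j
  proof -
    have mn: "real m + real n + 1 = real (Suc (n + q + 1))" by (simp add: q)
    have p: "pochhammer (real m + real n + 1) j = fact (n + q + 1 + j) / fact (n + q + 1)"
      "pochhammer (real m) j = fact (q + j) / fact q"
      by (simp_all only: mn pochhammer_Suc_of_nat, simp only: q pochhammer_Suc_of_nat)
    show ?thesis
      unfolding p C A_def by (simp add: add_ac flip: pochhammer_fact)
  qed
  then have A: "A = (\<lambda>j. C * ?t j)" by (rule ext)
  have "C * (integral {0..T} ?f / C) = integral {0..T} ?f"
    using T by (simp add: C)
  with sums have "(\<lambda>j. C * ?t j) sums (C * (integral {0..T} ?f / C))"
    unfolding A by simp
  then have "?t sums (integral {0..T} ?f / C)"
    using T by (subst (asm) sums_mult_iff) (auto simp: C)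
  then have "hyp2F1 1 (real m) (real m + real n + 1) T = integral {0..T} ?f / C"
    unfolding hyp2F1_def by (rule sums_unique[symmetric])
  then have "mu \<theta> m n = C * (integral {0..T} ?f / C)"
    by (simp add: mu_def C_def T_def)
  then have "mu \<theta> m n = integral {0..T} ?f"
    using T by (simp add: C)
  with fint show ?thesis
    unfolding u T_def[symmetric] q by (simp add: has_integral_integrable_integral)
qed

lemma has_integral_inverse_one_minus:
  fixes T :: real
  assumes "0 \<le> T" "T < 1"
  shows "((\<lambda>\<xi>. 1 / (1 - \<xi>)) has_integral - ln (1 - T)) {0..T}"
proof -
  have "((\<lambda>\<xi>. 1 / (1 - \<xi>)) has_integral (- ln (1 - T) - (- ln (1 - 0)))) {0..T}"
    using assms by (intro fundamental_theorem_of_calculus)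
      (auto intro!: derivative_eq_intros simp flip: has_real_derivative_iff_has_vector_derivative)
  then show ?thesis by simp
qed

text \<open>By the geometric sum, for \<open>\<xi> > 0\<close> the integrand is
  \<open>(\<theta>/2) / (\<xi> (1 - \<xi>))\<close> times \<open>(1 - u)^m - 1\<close>, the monomial
  with its value at \<open>u = 0\<close> removed.\<close>

lemma has_integral_lam:
  assumes "0 < \<theta>" "\<theta> < 2"
  shows "((\<lambda>\<xi>. - (\<Sum>i<m. (1 - 2*\<xi>/\<theta>) ^ i) / (1 - \<xi>)) has_integral lam \<theta> m) {0..\<theta>/2}"
proof -
  define T where "T = \<theta> / 2"
  have T: "0 < T" "T < 1" using assms by (auto simp: T_def)
  have u: "2 * \<xi> / \<theta> = \<xi> / T" for \<xi> by (simp add: T_def)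
  have pow: "((\<lambda>\<xi>. (1 - \<xi> / T) ^ i) has_integral T / real (Suc i)) {0..T}" for i
  proof -
    have "((\<lambda>\<xi>. 1 / T ^ i * ((T - \<xi>) ^ i * \<xi> ^ 0)) has_integral
       1 / T ^ i * (fact i * fact 0 / fact (i + 0 + 1) * T ^ (i + 0 + 1))) {0..T}"
      using T by (intro has_integral_mult_right has_integral_power_mult_power) auto
    moreover have "1 - \<xi> / T = (T - \<xi>) / T" for \<xi> using T by (simp add: field_simps)
    ultimately show ?thesis using T by (simp add: power_divide)
  qed
  have mu: "((\<lambda>\<xi>. (1 - \<xi> / T) ^ m / (1 - \<xi>)) has_integral mu \<theta> 1 m) {0..T}"
    using has_integral_mu[of \<theta> 1 m] assms unfolding u T_def[symmetric] by simp
  \<comment> \<open>The three terms integrate to the hypergeometric, harmonic and logarithmic parts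
    of \<open>lam\<close>.\<close>
  have "((\<lambda>\<xi>. T * ((1 - \<xi> / T) ^ m / (1 - \<xi>)) - (\<Sum>i<m. (1 - \<xi> / T) ^ i) - T * (1 / (1 - \<xi>)))
     has_integral T * mu \<theta> 1 m - (\<Sum>i<m. T / real (Suc i)) - T * (- ln (1 - T))) {0..T}"
    using T by (intro has_integral_diff has_integral_sum has_integral_mult_right
        has_integral_inverse_one_minus mu pow) auto
  also have "?this \<longleftrightarrow> ((\<lambda>\<xi>. - (\<Sum>i<m. (1 - \<xi>/T) ^ i) / (1 - \<xi>))
     has_integral T * mu \<theta> 1 m - (\<Sum>i<m. T / real (Suc i)) - T * (- ln (1 - T))) {0..T}"
  proof (rule has_integral_cong)
    fix \<xi> assume "\<xi> \<in> {0..T}"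
    then have x: "1 - \<xi> \<noteq> 0" using T by auto
    have g: "(1 - \<xi>/T) ^ m = 1 - \<xi>/T * (\<Sum>i<m. (1 - \<xi>/T) ^ i)"
      using one_diff_power_eq[of "1 - \<xi>/T" m] by simp
    show "T * ((1 - \<xi> / T) ^ m / (1 - \<xi>)) - (\<Sum>i<m. (1 - \<xi> / T) ^ i) - T * (1 / (1 - \<xi>)) =
       - (\<Sum>i<m. (1 - \<xi>/T) ^ i) / (1 - \<xi>)"
      unfolding g using x T by (simp add: divide_simps) (simp add: algebra_simps)
  qed
  also have "T * mu \<theta> 1 m - (\<Sum>i<m. T / real (Suc i)) - T * (- ln (1 - T)) = lam \<theta> m"
  proof -
    have "harm m = (\<Sum>i<m. 1 / real (Suc i))"
      by (induction m) (simp_all add: harm_def inverse_eq_divide)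
    then have "(\<Sum>i<m. T / real (Suc i)) = T * harm m"
      by (simp add: sum_distrib_left)
    moreover have "mu \<theta> 1 m = T * hyp2F1 1 1 (real m + 2) T / (real m + 1)"
      by (simp add: mu_def T_def add_ac)
    ultimately show ?thesis
      by (simp add: lam_def T_def[symmetric] algebra_simps)
  qed
  finally show ?thesis
    unfolding u T_def[symmetric] .
qed

text \<open>The antiderivative is \<open>ln \<xi> - ln (1 - \<xi>)\<close>; at
  \<open>T = \<theta>/2\<close> the value is the logarithm subtracted in the theorem.\<close>

lemma has_integral_log_kernel:
  fixes \<eta> T :: real
  assumes "0 < \<eta>" "\<eta> \<le> T" "T < 1"
  shows "((\<lambda>\<xi>. 1 / (\<xi> * (1 - \<xi>))) has_integral ln ((1 - \<eta>) / (\<eta> * (1 / T - 1)))) {\<eta>..T}"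
proof -
  have "((\<lambda>\<xi>. 1 / (\<xi> * (1 - \<xi>))) has_integral (ln T - ln (1 - T)) - (ln \<eta> - ln (1 - \<eta>))) {\<eta>..T}"
    using assms by (intro fundamental_theorem_of_calculus)
      (auto intro!: derivative_eq_intros simp: field_simps simp flip: has_real_derivative_iff_has_vector_derivative)
  moreover have "1 / T - 1 = (1 - T) / T" using assms by (simp add: field_simps)
  moreover have "ln ((1 - \<eta>) / (\<eta> * ((1 - T) / T))) = (ln T - ln (1 - T)) - (ln \<eta> - ln (1 - \<eta>))"
    using assms by (simp add: ln_mult ln_div)
  ultimately show ?thesis by simp
qed

text \<open>The weighted integrand splits into the weight times its value at \<open>u = 0\<close>
  and a remainder integrable on \<open>{0..\<theta>/2}\<close>. The first part integrates exactly to
  the logarithmic term, so the difference is the remainder's integral over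
  \<open>{\<eta>..\<theta>/2}\<close>.\<close>

lemma lincomb_limit:
  assumes "lincomb \<Lambda>" "0 < \<theta>" "\<theta> < 2"
  shows "((\<lambda>\<eta>. integral {\<eta>..\<theta>/2} (\<lambda>\<xi>. \<theta>/2 / (\<xi> * (1 - \<xi>)) *
             \<Lambda> (\<lambda>m. (1 - 2*\<xi>/\<theta>) ^ m) (\<lambda>m n. (2*\<xi>/\<theta>) ^ m * (1 - 2*\<xi>/\<theta>) ^ n))
           - \<theta>/2 * ln ((1 - \<eta>) / (\<eta> * (2/\<theta> - 1))) * \<Lambda> (\<lambda>m. (1 - 0) ^ m) (\<lambda>m n. 0 ^ m * (1 - 0) ^ n))
         \<longlongrightarrow> \<Lambda> (lam \<theta>) (mu \<theta>)) (at_right 0)"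
proof -
  \<comment> \<open>\<open>f\<close> and \<open>g\<close> are the remainders of the two kinds of
    weighted monomials; for \<open>g\<close> nothing is subtracted, since \<open>0 ^ m = 0\<close>
    for \<open>m > 0\<close>.\<close>
  define f where "f \<xi> m = - (\<Sum>i<m. (1 - 2*\<xi>/\<theta>) ^ i) / (1 - \<xi>)" for \<xi> :: real and m :: nat
  define g where "g \<xi> m n = (2*\<xi>/\<theta>) ^ (m - 1) * (1 - 2*\<xi>/\<theta>) ^ n / (1 - \<xi>)" for \<xi> :: real and m n :: nat
  let ?J = "\<Lambda> (\<lambda>m. (1 - 0) ^ m) (\<lambda>m n. 0 ^ m * (1 - 0) ^ n)"
  let ?h = "\<lambda>\<xi>. \<Lambda> (f \<xi>) (g \<xi>)"
  have h: "(?h has_integral \<Lambda> (lam \<theta>) (mu \<theta>)) {0..\<theta>/2}"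
  proof (rule lincomb_has_integral[OF assms(1)])
    show "((\<lambda>\<xi>. f \<xi> m) has_integral lam \<theta> m) {0..\<theta>/2}" for m
      unfolding f_def by (rule has_integral_lam[OF assms(2,3)])
    show "((\<lambda>\<xi>. g \<xi> m n) has_integral mu \<theta> m n) {0..\<theta>/2}" if "0 < m" for m n
      unfolding g_def by (rule has_integral_mu[OF assms(2,3) that])
  qed
  have split: "\<theta>/2 / (\<xi> * (1 - \<xi>)) *
             \<Lambda> (\<lambda>m. (1 - 2*\<xi>/\<theta>) ^ m) (\<lambda>m n. (2*\<xi>/\<theta>) ^ m * (1 - 2*\<xi>/\<theta>) ^ n) =
         \<theta>/2 / (\<xi> * (1 - \<xi>)) * ?J + ?h \<xi>" if x: "0 < \<xi>" "\<xi> \<le> \<theta>/2" for \<xi>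
  proof (rule lincomb_affine[OF assms(1)])
    fix m n :: nat assume m: "0 < m"
    have p: "(1 - 2*\<xi>/\<theta>) ^ m = 1 - 2*\<xi>/\<theta> * (\<Sum>i<m. (1 - 2*\<xi>/\<theta>) ^ i)"
      using one_diff_power_eq[of "1 - 2*\<xi>/\<theta>" m] by simp
    have u: "\<theta>/2 / (\<xi> * (1 - \<xi>)) * (2*\<xi>/\<theta>) = 1 / (1 - \<xi>)"
      using x assms by simp
    have split: "\<kappa> * (1 - v * \<sigma>) = \<kappa> - \<kappa> * v * \<sigma>" for \<kappa> v \<sigma> :: real
      by (simp add: right_diff_distrib)
    show "\<theta>/2 / (\<xi> * (1 - \<xi>)) * (1 - 2*\<xi>/\<theta>) ^ m = \<theta>/2 / (\<xi> * (1 - \<xi>)) * (1 - 0) ^ m + f \<xi> m"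
      unfolding p f_def split u by simp
    show "\<theta>/2 / (\<xi> * (1 - \<xi>)) * ((2*\<xi>/\<theta>) ^ m * (1 - 2*\<xi>/\<theta>) ^ n) =
        \<theta>/2 / (\<xi> * (1 - \<xi>)) * (0 ^ m * (1 - 0) ^ n) + g \<xi> m n"
    proof -
      obtain m' where m': "m = Suc m'" using m by (cases m) auto
      have "\<theta>/2 / (\<xi> * (1 - \<xi>)) * ((2*\<xi>/\<theta>) ^ m * (1 - 2*\<xi>/\<theta>) ^ n)
          = (\<theta>/2 / (\<xi> * (1 - \<xi>)) * (2*\<xi>/\<theta>)) * ((2*\<xi>/\<theta>) ^ m' * (1 - 2*\<xi>/\<theta>) ^ n)"
        unfolding m' power_Suc by (simp only: mult.assoc)
      also have "\<dots> = g \<xi> m n" unfolding u by (simp add: g_def m')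
      finally show ?thesis using m by simp
    qed
  qed
  have "integral {\<eta>..\<theta>/2} (\<lambda>\<xi>. \<theta>/2 / (\<xi> * (1 - \<xi>)) *
             \<Lambda> (\<lambda>m. (1 - 2*\<xi>/\<theta>) ^ m) (\<lambda>m n. (2*\<xi>/\<theta>) ^ m * (1 - 2*\<xi>/\<theta>) ^ n))
           - \<theta>/2 * ln ((1 - \<eta>) / (\<eta> * (2/\<theta> - 1))) * ?J = integral {\<eta>..\<theta>/2} ?h"
    if eta: "0 < \<eta>" "\<eta> < \<theta>/2" for \<eta>
  proof -
    have "?h integrable_on {\<eta>..\<theta>/2}"
      by (rule integrable_on_subinterval[OF has_integral_integrable[OF h]]) (use eta in auto)
    moreover have "((\<lambda>\<xi>. 1 / (\<xi> * (1 - \<xi>))) has_integral ln ((1 - \<eta>) / (\<eta> * (2 / \<theta> - 1)))) {\<eta>..\<theta>/2}"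
      using has_integral_log_kernel[of \<eta> "\<theta>/2"] eta assms by simp
    ultimately have "((\<lambda>\<xi>. \<theta>/2 * ?J * (1 / (\<xi> * (1 - \<xi>))) + ?h \<xi>) has_integral
        \<theta>/2 * ?J * ln ((1 - \<eta>) / (\<eta> * (2 / \<theta> - 1))) + integral {\<eta>..\<theta>/2} ?h) {\<eta>..\<theta>/2}"
      by (intro has_integral_add has_integral_mult_right integrable_integral)
    also have "?this \<longleftrightarrow> ((\<lambda>\<xi>. \<theta>/2 / (\<xi> * (1 - \<xi>)) *
             \<Lambda> (\<lambda>m. (1 - 2*\<xi>/\<theta>) ^ m) (\<lambda>m n. (2*\<xi>/\<theta>) ^ m * (1 - 2*\<xi>/\<theta>) ^ n)) has_integral
        \<theta>/2 * ?J * ln ((1 - \<eta>) / (\<eta> * (2 / \<theta> - 1))) + integral {\<eta>..\<theta>/2} ?h) {\<eta>..\<theta>/2}"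
    proof (rule has_integral_cong)
      fix \<xi> assume "\<xi> \<in> {\<eta>..\<theta>/2}"
      then have x: "0 < \<xi>" "\<xi> \<le> \<theta>/2" using eta by auto
      have frac: "p * J * (1 / w) = p / w * J" for p J w :: real by simp
      show "\<theta>/2 * ?J * (1 / (\<xi> * (1 - \<xi>))) + ?h \<xi> = \<theta>/2 / (\<xi> * (1 - \<xi>)) *
             \<Lambda> (\<lambda>m. (1 - 2*\<xi>/\<theta>) ^ m) (\<lambda>m n. (2*\<xi>/\<theta>) ^ m * (1 - 2*\<xi>/\<theta>) ^ n)"
        unfolding split[OF x] frac ..
    qed
    finally show ?thesis
      by (simp add: integral_unique algebra_simps)
  qed
  \<comment> \<open>Continuity of the integral in its lower limit gives existence and value of the
    limit together.\<close>
  moreover have "((\<lambda>\<eta>. integral {\<eta>..\<theta>/2} ?h) \<longlongrightarrow> integral {0..\<theta>/2} ?h) (at_right 0)"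
    using assms
    by (intro continuous_on_Icc_at_rightD[of 0 "\<theta>/2"] indefinite_integral_continuous_1'
        has_integral_integrable[OF h]) auto
  moreover have "eventually (\<lambda>\<eta>. \<eta> \<in> {0<..<\<theta>/2}) (at_right 0)"
    using assms by (intro eventually_at_right_real) auto
  ultimately show ?thesis
    unfolding integral_unique[OF h]
    by (elim Lim_transform_eventually) (auto elim: eventually_mono)
qed

theorem theorem4:
  fixes k s :: nat and \<theta> :: real and a :: "nat \<Rightarrow> real" and b c :: "nat \<Rightarrow> nat"
  assumes "2 \<le> k" and "0 < \<theta>" and "\<theta> \<le> 1"
  shows "((\<lambda>\<eta>. Lk k \<theta> s a b c \<eta>
             - \<theta>/2 * ln ((1 - \<eta>) / (\<eta> * (2/\<theta> - 1))) * Jk k s a b c)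
            \<longlongrightarrow> Ltilde_formula k \<theta> s a b c) (at_right 0)
       \<and> ((\<lambda>\<eta>. Mk k \<theta> s a b c \<eta>
             - \<theta>^2/4 * ln ((1 - \<eta>) / (\<eta> * (2/\<theta> - 1))) * Jk k s a b c)
            \<longlongrightarrow> Mtilde_formula k \<theta> s a b c) (at_right 0)"
proof -
  let ?w = "\<lambda>\<xi>. \<theta>/2 / (\<xi> * (1 - \<xi>))"
  let ?A = "\<lambda>\<Lambda> \<xi>. ?w \<xi> * \<Lambda> (\<lambda>m. (1 - 2*\<xi>/\<theta>) ^ m) (\<lambda>m n. (2*\<xi>/\<theta>) ^ m * (1 - 2*\<xi>/\<theta>) ^ n)"
  have L: "lincomb (Lgen k s a b c)" and M: "lincomb (Mgen k s a b c)"
    using assms by (auto intro: lincomb_Lgen lincomb_Mgen)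
  \<comment> \<open>The weight factor is \<open>\<theta>/2 - \<xi> = (\<theta>/2) (1 - u)\<close>,
    which cancels the Jacobian of the substitution, twice for \<open>M\<close>.\<close>
  have cancel: "(\<theta>/2 - \<xi>) * (1 / (1 - 2*\<xi>/\<theta>)) = \<theta>/2" if "\<xi> \<noteq> \<theta>/2" for \<xi>
    using that assms by (simp add: field_simps)
  have zero: "?A \<Lambda> (\<theta>/2) = 0" if "lincomb \<Lambda>" for \<Lambda>
    using lincomb_eq_0[OF that] assms by simp
  have "(\<theta>/2 - \<xi>) / (\<xi> * (1 - \<xi>)) * cube_int k (\<lambda>y. innerFxi k \<theta> \<xi> s a b c y * innerF k s a b c y)
      = ?A (Lgen k s a b c) \<xi>" if x: "0 < \<xi>" "\<xi> \<le> \<theta>/2" for \<xi>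
  proof (cases "\<xi> = \<theta>/2")
    case True
    show ?thesis unfolding True zero[OF L] by simp
  next
    case False
    have c: "cube_int k (\<lambda>y. innerFxi k \<theta> \<xi> s a b c y * innerF k s a b c y) =
        1 / (1 - 2*\<xi>/\<theta>) * Lgen k s a b c (\<lambda>m. (1 - 2*\<xi>/\<theta>) ^ m) (\<lambda>m n. (2*\<xi>/\<theta>) ^ m * (1 - 2*\<xi>/\<theta>) ^ n)"
      using x False assms by (intro cube_int_innerFxi_mult_innerF) auto
    have frac: "x / w * (1 / d * y) = x * (1 / d) / w * y" for x w d y :: real by simp
    show ?thesis
      unfolding c frac cancel[OF False] ..
  qed
  then have Lk: "Lk k \<theta> s a b c \<eta> = integral {\<eta>..\<theta>/2} (?A (Lgen k s a b c))" if "0 < \<eta>" for \<eta>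
    unfolding Lk_def using that by (intro integral_cong) auto
  have "(\<theta>/2 - \<xi>)\<^sup>2 / (\<xi> * (1 - \<xi>)) * cube_int k (\<lambda>y. (innerFxi k \<theta> \<xi> s a b c y)\<^sup>2)
      = \<theta>/2 * ?A (Mgen k s a b c) \<xi>" if x: "0 < \<xi>" "\<xi> \<le> \<theta>/2" for \<xi>
  proof (cases "\<xi> = \<theta>/2")
    case True
    show ?thesis unfolding True zero[OF M] by simp
  next
    case False
    let ?m = "Mgen k s a b c (\<lambda>m. (1 - 2*\<xi>/\<theta>) ^ m) (\<lambda>m n. (2*\<xi>/\<theta>) ^ m * (1 - 2*\<xi>/\<theta>) ^ n)"
    have c: "cube_int k (\<lambda>y. (innerFxi k \<theta> \<xi> s a b c y)\<^sup>2) = (1 / (1 - 2*\<xi>/\<theta>))\<^sup>2 * ?m"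
      using x False assms by (intro cube_int_innerFxi_power2) auto
    have "(\<theta>/2 - \<xi>)\<^sup>2 / (\<xi> * (1 - \<xi>)) * ((1 / (1 - 2*\<xi>/\<theta>))\<^sup>2 * ?m)
        = ((\<theta>/2 - \<xi>) * (1 / (1 - 2*\<xi>/\<theta>)))\<^sup>2 / (\<xi> * (1 - \<xi>)) * ?m"
      by (simp only: power_mult_distrib mult.assoc times_divide_eq_left)
    then show ?thesis
      unfolding c cancel[OF False] by (simp add: power2_eq_square)
  qed
  then have Mk: "Mk k \<theta> s a b c \<eta> = \<theta>/2 * integral {\<eta>..\<theta>/2} (?A (Mgen k s a b c))" if "0 < \<eta>" for \<eta>
    unfolding Mk_def integral_mult_right[symmetric] using that by (intro integral_cong) auto
  \<comment> \<open>The second factor \<open>\<theta>/2\<close> in \<open>M\<close> turns the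
    coefficient \<open>\<theta>/2\<close> of the logarithm into \<open>\<theta>^2/4\<close>.\<close>
  have scale: "\<theta>/2 * (I - \<theta>/2 * l * J) = \<theta>/2 * I - \<theta>\<^sup>2/4 * l * J" for I l J
    by (simp add: power2_eq_square algebra_simps)
  have ev: "eventually (\<lambda>\<eta>::real. 0 < \<eta>) (at_right 0)"
    by (rule eventually_at_right_less)
  have "((\<lambda>\<eta>. Lk k \<theta> s a b c \<eta>
             - \<theta>/2 * ln ((1 - \<eta>) / (\<eta> * (2/\<theta> - 1))) * Jk k s a b c)
            \<longlongrightarrow> Ltilde_formula k \<theta> s a b c) (at_right 0)"
    unfolding Ltilde_formula_eq Jk_eq(1)[OF assms(1)]
  proof (rule Lim_transform_eventually[OF lincomb_limit[OF L]])
    show "\<forall>\<^sub>F \<eta> in at_right 0. integral {\<eta>..\<theta>/2} (?A (Lgen k s a b c))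
           - \<theta>/2 * ln ((1 - \<eta>) / (\<eta> * (2/\<theta> - 1))) * Lgen k s a b c (\<lambda>m. (1 - 0) ^ m) (\<lambda>m n. 0 ^ m * (1 - 0) ^ n)
        = Lk k \<theta> s a b c \<eta>
             - \<theta>/2 * ln ((1 - \<eta>) / (\<eta> * (2/\<theta> - 1))) * Lgen k s a b c (\<lambda>m. (1 - 0) ^ m) (\<lambda>m n. 0 ^ m * (1 - 0) ^ n)"
      using ev by eventually_elim (simp only: Lk)
  qed (use assms in auto)
  moreover have "((\<lambda>\<eta>. Mk k \<theta> s a b c \<eta>
             - \<theta>^2/4 * ln ((1 - \<eta>) / (\<eta> * (2/\<theta> - 1))) * Jk k s a b c)
            \<longlongrightarrow> Mtilde_formula k \<theta> s a b c) (at_right 0)"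
    unfolding Mtilde_formula_eq Jk_eq(2)[OF assms(1)]
  proof (rule Lim_transform_eventually[OF tendsto_mult_left[OF lincomb_limit[OF M], of _ "\<theta>/2"]])
    show "\<forall>\<^sub>F \<eta> in at_right 0. \<theta>/2 * (integral {\<eta>..\<theta>/2} (?A (Mgen k s a b c))
           - \<theta>/2 * ln ((1 - \<eta>) / (\<eta> * (2/\<theta> - 1))) * Mgen k s a b c (\<lambda>m. (1 - 0) ^ m) (\<lambda>m n. 0 ^ m * (1 - 0) ^ n))
        = Mk k \<theta> s a b c \<eta>
             - \<theta>^2/4 * ln ((1 - \<eta>) / (\<eta> * (2/\<theta> - 1))) * Mgen k s a b c (\<lambda>m. (1 - 0) ^ m) (\<lambda>m n. 0 ^ m * (1 - 0) ^ n)"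
      using ev by eventually_elim (simp only: Mk scale)
  qed (use assms in auto)
  ultimately show ?thesis ..
qed

end
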